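(* Suppose $\mathrm{R}^{\mathcal{H}}$ on $\mathcal{H}^r$ and $\mathrm{R}^{\mathrm{St}}$ on $\mathrm{St}(n,r)$ are orthogonally homogeneous retractions associated with compatible vector transports $\mathcal{T}^{\mathcal{H}}$ and $\mathcal{T}^{\mathrm{St}}$, respectively, and let the retraction $\mathrm{R}$ on $\mathcal{M}_h$ be given by $$\mathrm{R}_{(X,G)}(\eta,\zeta)=\Big(\mathrm{R}^{\mathcal{H}}_H(K)\big(\mathrm{R}^{\mathrm{St}}_V(V_p)\big)^\top,\ I-\mathrm{R}^{\mathrm{St}}_V(V_p)\big(\mathrm{R}^{\mathrm{St}}_V(V_p)\big)^\top\Big)$$ for representations $(H,V)$ of $(X,G)$ and $(K,V_p)$ of $(\eta,\zeta)$. For $\big((X,G),(\tilde\eta,\tilde\zeta),(\eta,\zeta)\big)\in\mathrm{T}\mathcal{M}_h\oplus\mathrm{T}\mathcal{M}_h$ with representations $(H,V)$, $(\tilde K,\tilde V_p)$ and $(K,V_p)$, respectively, let $\tilde H=\mathrm{R}^{\mathcal{H}}_H(\tilde K)$ and $\tilde V=\mathrm{R}^{\mathrm{St}}_V(\tilde V_p)$. Then a vector transport $\mathcal{T}_{(\tilde\eta,\tilde\zeta)}(\eta,\zeta)$ on $\mathcal{M}_h$ (associated with $\mathrm{R}$) is given by the tangent vector at $\mathrm{R}_{(X,G)}(\tilde\eta,\tilde\zeta)$ represented, with respect to $(\tilde H,\tilde V)$, by $$\bar K=\mathcal{T}^{\mathcal{H}}_{\tilde K}(K)\quad\text{and}\quad\bar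 V_p=(I-\tilde V\tilde V^\top)\,\mathcal{T}^{\mathrm{St}}_{\tilde V_p}(V_p).$$
   Context: Let $r\le\min\{m,n\}$ be a positive integer. The map $h:\mathbb{R}^{m\times n}\to\mathbb{R}^q$ is smooth and orthogonally invariant, i.e. $h(XQ)=h(X)$ for all $X$ and all $Q\in\mathcal{O}(n)=\{Q\in\mathbb{R}^{n\times n}:Q^\top Q=I_n\}$. Put $\mathcal{H}=\{X\in\mathbb{R}^{m\times n}:h(X)=0\}$; it is assumed that the differential $\mathrm{D}h_X$ has rank $q$ for all $X\in\mathcal{H}$. Define $\mathcal{H}^r=\{H\in\mathbb{R}^{m\times r}:h([H\ \ 0^{m\times(n-r)}])=0\}$, an embedded submanifold of $\mathbb{R}^{m\times r}$ when nonempty. $\mathrm{Sym}(n)$: symmetric $n\times n$ matrices; $\mathrm{Gr}(n,n-r)=\{G\in\mathrm{Sym}(n):G^2=G,\operatorname{rank}(G)=n-r\}$; $\mathrm{St}(n,r)=\{V\in\mathbb{R}^{n\times r}:V^\top V=I_r\}$. Define $\mathcal{M}_h=\{(X,G)\in\mathbb{R}^{m\times n}\times\mathrm{Gr}(n,n-r):XG=0,\ h(X)=0\}$, an embedded submanifold of $\mathbb{R}^{m\times n}\times\mathrm{Sym}(n)$. A representation of $(X,G)\in\mathcal{M}_h$ is a pair $(H,V)\in\mathcal{H}^r\times\mathrm{St}(n,r)$ with $X=HV^\top$, $G=I-VV^\top$ (one always exists). The tangent space is $\mathrm{T}_{(X,G)}\mathcal{M}_h=\{(KV^\top+HV_p^\top,-V_pV^\top-VV_p^\top):K\in\mathrm{T}_H\mathcal{H}^r,\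 V_p\in\mathbb{R}^{n\times r},\ V^\top V_p=0\}$; $(K,V_p)$ is said to represent (with respect to $(H,V)$) the tangent vector $(KV^\top+HV_p^\top,-V_pV^\top-VV_p^\top)$. Retraction: a smooth $\mathrm{R}:\mathrm{T}\mathcal{M}\to\mathcal{M}$ such that for $X\in\mathcal{M}$, $\xi\in\mathrm{T}_X\mathcal{M}$ the curve $\gamma(t)=\mathrm{R}_X(t\xi)$ satisfies $\gamma(0)=X$, $\gamma'(0)=\xi$. Vector transport: with $\mathrm{T}\mathcal{M}\oplus\mathrm{T}\mathcal{M}=\{(X,\tilde\xi,\xi):X\in\mathcal{M},\ \tilde\xi,\xi\in\mathrm{T}_X\mathcal{M}\}$, a smooth map $\mathrm{T}\mathcal{M}\oplus\mathrm{T}\mathcal{M}\to\mathrm{T}\mathcal{M}$, $(X,\tilde\xi,\xi)\mapsto\mathcal{T}_{\tilde\xi}(\xi)$, for which there is an associated retraction $\mathrm{R}$ with $\mathcal{T}_{\tilde\xi}(\xi)\in\mathrm{T}_{\mathrm{R}_X(\tilde\xi)}\mathcal{M}$, such that $\mathcal{T}_0(\xi)=\xi$ and $\xi\mapsto\mathcal{T}_{\tilde\xi}(\xi)$ is linear. Let $\mathcal{M}\subseteq\mathbb{R}^{a\times b}$ be a manifold closed under $X\mapsto XQ$, $Q\in\mathcal{O}(b)$. A retraction is orthogonally homogeneous if $\mathrm{R}_X(\xi)Q=\mathrm{R}_{XQ}(\xi Q)$ for all $Q\in\mathcal{O}(b)$, $(X,\xi)\in\mathrm{T}\mathcal{M}$.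 A vector transport $\mathcal{T}$ and its associated orthogonally homogeneous retraction are compatible if $\mathcal{T}_{\tilde\xi}(\xi)Q=\mathcal{T}_{\tilde\xi Q}(\xi Q)$ for all $Q\in\mathcal{O}(b)$, $X\in\mathcal{M}$, $\tilde\xi,\xi\in\mathrm{T}_X\mathcal{M}$ (where $\tilde\xi Q,\xi Q\in\mathrm{T}_{XQ}\mathcal{M}$). *)

theory Defs
  imports "HOL-Analysis.Analysis"
begin

section \<open>Smooth maps\<close>

text \<open>
  For open \<open>S\<close> in a finite-dimensional space, \<open>Ck_on k S f\<close> is \<open>k\<close>-fold continuous
  differentiability: all iterated directional derivatives up to order \<open>k\<close> exist and are
  continuous.  It is only meant to be used for open \<open>S\<close>.
\<close>

primrec Ck_on :: "nat \<Rightarrow> 'a::euclidean_space set \<Rightarrow> ('a \<Rightarrow> 'b::real_normed_vector) \<Rightarrow> bool" where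
  "Ck_on 0 S f \<longleftrightarrow> continuous_on S f"
| "Ck_on (Suc k) S f \<longleftrightarrow> (\<forall>x\<in>S. f differentiable (at x)) \<and>
     (\<forall>v. Ck_on k S (\<lambda>x. frechet_derivative f (at x) v))"

definition smooth_on :: "'a::euclidean_space set \<Rightarrow> ('a \<Rightarrow> 'b::real_normed_vector) \<Rightarrow> bool" where
  "smooth_on S f \<longleftrightarrow> (\<forall>k. Ck_on k S f)"

text \<open>
  Smoothness of a map on an arbitrary subset \<open>M\<close> of a Euclidean space: locally the restriction
  of a smooth map defined on an open set of the ambient space.  If \<open>M\<close> is an embedded
  submanifold, this is the usual notion; for a map into another embedded submanifold one may
  regard it as a map into the ambient space.
\<close>

definition smooth_map_on :: "'a::euclidean_space set \<Rightarrow> ('a \<Rightarrow> 'b::real_normed_vector) \<Rightarrow> bool" where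
  "smooth_map_on M f \<longleftrightarrow>
     (\<forall>x\<in>M. \<exists>U g. open U \<and> x \<in> U \<and> smooth_on U g \<and> (\<forall>y\<in>U \<inter> M. g y = f y))"


section \<open>Tangent vectors, retractions and vector transports\<close>

text \<open>
  Manifolds are embedded submanifolds of a Euclidean space, represented by their underlying
  sets; a tangent vector is the velocity at \<open>0\<close> of a smooth curve in the set.
\<close>

definition tangent_space :: "'a::euclidean_space set \<Rightarrow> 'a \<Rightarrow> 'a set" where
  "tangent_space M x =
     {v. \<exists>c e. 0 < e \<and> smooth_on {-e<..<e} c \<and> (\<forall>t\<in>{-e<..<e}. c t \<in> M) \<and>
           c 0 = x \<and> (c has_vector_derivative v) (at (0::real))}"

definition tangent_bundle :: "'a::euclidean_space set \<Rightarrow> ('a \<times> 'a) set" where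
  "tangent_bundle M = (SIGMA x:M. tangent_space M x)"

definition tangent_bundle_sum :: "'a::euclidean_space set \<Rightarrow> ('a \<times> 'a \<times> 'a) set" where
  "tangent_bundle_sum M = (SIGMA x:M. tangent_space M x \<times> tangent_space M x)"

text \<open>\<open>R x v\<close> stands for \<open>R\<^sub>x(v)\<close>; its values off the tangent bundle are irrelevant.\<close>

definition retraction_on :: "'a::euclidean_space set \<Rightarrow> ('a \<Rightarrow> 'a \<Rightarrow> 'a) \<Rightarrow> bool" where
  "retraction_on M R \<longleftrightarrow>
     (\<forall>(x, v) \<in> tangent_bundle M. R x v \<in> M) \<and>
     smooth_map_on (tangent_bundle M) (\<lambda>(x, v). R x v) \<and>
     (\<forall>(x, v) \<in> tangent_bundle M.
        R x 0 = x \<and> ((\<lambda>t. R x (t *\<^sub>R v)) has_vector_derivative v) (at 0))"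

text \<open>
  \<open>T x u v\<close> is the transport of \<open>v\<close> along \<open>u\<close>, both tangent at \<open>x\<close>.  As a map into the tangent
  bundle the transport is \<open>(x, u, v) \<mapsto> (R x u, T x u v)\<close>.
\<close>

definition vector_transport_on ::
  "'a::euclidean_space set \<Rightarrow> ('a \<Rightarrow> 'a \<Rightarrow> 'a) \<Rightarrow> ('a \<Rightarrow> 'a \<Rightarrow> 'a \<Rightarrow> 'a) \<Rightarrow> bool" where
  "vector_transport_on M R T \<longleftrightarrow>
     retraction_on M R \<and>
     (\<forall>(x, u, v) \<in> tangent_bundle_sum M. T x u v \<in> tangent_space M (R x u)) \<and>
     smooth_map_on (tangent_bundle_sum M) (\<lambda>(x, u, v). (R x u, T x u v)) \<and>
     (\<forall>(x, v) \<in> tangent_bundle M. T x 0 v = v) \<and>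
     (\<forall>x\<in>M. \<forall>u\<in>tangent_space M x. \<forall>v\<in>tangent_space M x. \<forall>w\<in>tangent_space M x. \<forall>a b::real.
        T x u (a *\<^sub>R v + b *\<^sub>R w) = a *\<^sub>R T x u v + b *\<^sub>R T x u w)"

definition orthogonally_homogeneous ::
  "(real^'b^'a) set \<Rightarrow> (real^'b^'a \<Rightarrow> real^'b^'a \<Rightarrow> real^'b^'a) \<Rightarrow> bool" where
  "orthogonally_homogeneous M R \<longleftrightarrow>
     (\<forall>Q. orthogonal_matrix Q \<longrightarrow>
        (\<forall>(X, \<xi>) \<in> tangent_bundle M. R X \<xi> ** Q = R (X ** Q) (\<xi> ** Q)))"

definition compatible_transport ::
  "(real^'b^'a) set \<Rightarrow> (real^'b^'a \<Rightarrow> real^'b^'a \<Rightarrow> real^'b^'a) \<Rightarrow>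
   (real^'b^'a \<Rightarrow> real^'b^'a \<Rightarrow> real^'b^'a \<Rightarrow> real^'b^'a) \<Rightarrow> bool" where
  "compatible_transport M R T \<longleftrightarrow>
     vector_transport_on M R T \<and> orthogonally_homogeneous M R \<and>
     (\<forall>Q. orthogonal_matrix Q \<longrightarrow>
        (\<forall>(X, \<xi>', \<xi>) \<in> tangent_bundle_sum M.
           T X \<xi>' \<xi> ** Q = T (X ** Q) (\<xi>' ** Q) (\<xi> ** Q)))"


section \<open>The manifolds\<close>

definition orthogonally_invariant :: "(real^'n^'m \<Rightarrow> 'b) \<Rightarrow> bool" where
  "orthogonally_invariant h \<longleftrightarrow> (\<forall>X Q. orthogonal_matrix Q \<longrightarrow> h (X ** Q) = h X)"

text \<open>
  The block matrix \<open>[H 0]\<close>.  Column index types are unordered, so the positions of the columns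
  of \<open>H\<close> are specified by an injection \<open>\<iota>\<close> of \<open>'r\<close> into \<open>'n\<close>.
\<close>

definition pad_columns :: "('r \<Rightarrow> 'n) \<Rightarrow> real^'r^'m \<Rightarrow> real^'n^'m" where
  "pad_columns \<iota> H = (\<chi> i j. if j \<in> range \<iota> then H $ i $ inv \<iota> j else 0)"

definition Hr :: "(real^'n^'m \<Rightarrow> real^'q) \<Rightarrow> ('r \<Rightarrow> 'n) \<Rightarrow> (real^'r^'m) set" where
  "Hr h \<iota> = {H. h (pad_columns \<iota> H) = 0}"

definition Stiefel :: "(real^'r^'n) set" where
  "Stiefel = {V. transpose V ** V = mat 1}"

definition Grassmann :: "nat \<Rightarrow> (real^'n^'n) set" where
  "Grassmann k = {G. transpose G = G \<and> G ** G = G \<and> rank G = k}"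

text \<open>
  \<open>Mh r h\<close> is regarded as a subset of all pairs of matrices, not only of those with symmetric
  second component; since symmetric matrices form a linear subspace, neither tangent vectors nor
  smoothness are affected.
\<close>

definition Mh :: "nat \<Rightarrow> (real^'n^'m \<Rightarrow> real^'q) \<Rightarrow> ((real^'n^'m) \<times> (real^'n^'n)) set" where
  "Mh r h = {(X, G). G \<in> Grassmann (CARD('n) - r) \<and> X ** G = 0 \<and> h X = 0}"


section \<open>Representations and induced maps\<close>

definition represents ::
  "(real^'n^'m \<Rightarrow> real^'q) \<Rightarrow> ('r \<Rightarrow> 'n) \<Rightarrow>
   (real^'r^'m) \<times> (real^'r^'n) \<Rightarrow> (real^'n^'m) \<times> (real^'n^'n) \<Rightarrow> bool" where
  "represents h \<iota> = (\<lambda>(H, V) (X, G).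
     H \<in> Hr h \<iota> \<and> V \<in> Stiefel \<and> X = H ** transpose V \<and> G = mat 1 - V ** transpose V)"

text \<open>\<open>represents_tangent h \<iota> (H, V) (K, W) \<xi>\<close>: \<open>(K, W)\<close> represents \<open>\<xi>\<close> with respect to \<open>(H, V)\<close>.\<close>

definition represents_tangent ::
  "(real^'n^'m \<Rightarrow> real^'q) \<Rightarrow> ('r \<Rightarrow> 'n) \<Rightarrow> (real^'r^'m) \<times> (real^'r^'n) \<Rightarrow>
   (real^'r^'m) \<times> (real^'r^'n) \<Rightarrow> (real^'n^'m) \<times> (real^'n^'n) \<Rightarrow> bool" where
  "represents_tangent h \<iota> = (\<lambda>(H, V) (K, W) (\<eta>, \<zeta>).
     K \<in> tangent_space (Hr h \<iota>) H \<and> transpose V ** W = 0 \<and>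
     \<eta> = K ** transpose V + H ** transpose W \<and>
     \<zeta> = - (W ** transpose V) - V ** transpose W)"

definition induced_retraction ::
  "(real^'n^'m \<Rightarrow> real^'q) \<Rightarrow> ('r \<Rightarrow> 'n) \<Rightarrow>
   (real^'r^'m \<Rightarrow> real^'r^'m \<Rightarrow> real^'r^'m) \<Rightarrow>
   (real^'r^'n \<Rightarrow> real^'r^'n \<Rightarrow> real^'r^'n) \<Rightarrow>
   ((real^'n^'m) \<times> (real^'n^'n) \<Rightarrow> (real^'n^'m) \<times> (real^'n^'n) \<Rightarrow>
     (real^'n^'m) \<times> (real^'n^'n)) \<Rightarrow> bool" where
  "induced_retraction h \<iota> RH RSt R \<longleftrightarrow>
     (\<forall>(p, \<xi>) \<in> tangent_bundle (Mh CARD('r) h). \<forall>H V K W.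
        represents h \<iota> (H, V) p \<longrightarrow> represents_tangent h \<iota> (H, V) (K, W) \<xi> \<longrightarrow>
        R p \<xi> = (RH H K ** transpose (RSt V W), mat 1 - RSt V W ** transpose (RSt V W)))"

definition induced_transport ::
  "(real^'n^'m \<Rightarrow> real^'q) \<Rightarrow> ('r \<Rightarrow> 'n) \<Rightarrow>
   (real^'r^'m \<Rightarrow> real^'r^'m \<Rightarrow> real^'r^'m) \<Rightarrow>
   (real^'r^'m \<Rightarrow> real^'r^'m \<Rightarrow> real^'r^'m \<Rightarrow> real^'r^'m) \<Rightarrow>
   (real^'r^'n \<Rightarrow> real^'r^'n \<Rightarrow> real^'r^'n) \<Rightarrow>
   (real^'r^'n \<Rightarrow> real^'r^'n \<Rightarrow> real^'r^'n \<Rightarrow> real^'r^'n) \<Rightarrow>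
   ((real^'n^'m) \<times> (real^'n^'n) \<Rightarrow> (real^'n^'m) \<times> (real^'n^'n) \<Rightarrow> (real^'n^'m) \<times> (real^'n^'n) \<Rightarrow>
     (real^'n^'m) \<times> (real^'n^'n)) \<Rightarrow> bool" where
  "induced_transport h \<iota> RH TH RSt TSt T \<longleftrightarrow>
     (\<forall>(p, \<xi>', \<xi>) \<in> tangent_bundle_sum (Mh CARD('r) h). \<forall>H V K' W' K W.
        represents h \<iota> (H, V) p \<longrightarrow>
        represents_tangent h \<iota> (H, V) (K', W') \<xi>' \<longrightarrow>
        represents_tangent h \<iota> (H, V) (K, W) \<xi> \<longrightarrow>
        (let H' = RH H K'; V' = RSt V W' in
           represents_tangent h \<iota> (H', V')
             (TH H K' K, (mat 1 - V' ** transpose V') ** TSt V W' W)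
             (T p \<xi>' \<xi>)))"

end

theory Submission
  imports Defs
begin

text \<open>
  A point \<open>(X, G)\<close> of \<open>Mh\<close> consists of a projection \<open>I - G\<close> of rank \<open>r\<close> and a matrix \<open>X\<close> that vanishes on
  the kernel of this projection. Choosing an orthonormal basis of the range of \<open>I - G\<close>, as the columns of
  \<open>V\<close>, gives \<open>G = I - VV\<^sup>T\<close> and \<open>X = HV\<^sup>T\<close> with \<open>H = XV\<close>, and any other representation of the same point is
  \<open>(HQ, VQ)\<close> with \<open>Q\<close> orthogonal (\<open>represents_unique\<close>). A tangent vector \<open>(\<eta>, \<zeta>)\<close> is represented with
  respect to \<open>(H, V)\<close> by exactly one pair, namely \<open>K = \<eta>V\<close>, \<open>V\<^sub>p = - \<zeta>V\<close> (\<open>represents_tangent_determined\<close>).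
  These are linear in the tangent vector, and they are multiplied by \<open>Q\<close> from the right when \<open>(H, V)\<close> is.
  Orthogonal homogeneity of the two retractions and compatibility of the two transports say that their
  values are multiplied by \<open>Q\<close> as well, and the formulas in the theorem do not see this factor. Hence the
  retraction and the transport on \<open>Mh\<close> are well defined, and their algebraic properties are inherited
  from the factors.

  Two points need more than algebra. The first is smoothness. Near a given point the frame \<open>V\<close> has to be
  chosen as a smooth function of \<open>G\<close>. Projecting a fixed orthonormal basis of the range at the given point to
  the range of the nearby projection and applying the Gram-Schmidt process does this
  (\<open>local_orthonormalization\<close>, \<open>Stiefel_section_ex\<close>). With such a frame, \<open>H\<close>, \<open>K\<close> and \<open>V\<^sub>p\<close> are smooth
  functions as well, and the maps on \<open>Mh\<close> are locally compositions of smooth maps.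

  The second is the description of the tangent space, defined by velocities of curves. Given a curve in \<open>Mh\<close>,
  the smooth frame lifts it to curves in \<open>Hr\<close> and in the Stiefel manifold with velocities \<open>H'\<close> and \<open>V'\<close>.
  The latter has a component \<open>V\<Omega>\<close> along the fibre, with \<open>\<Omega> = V\<^sup>T V'\<close> skew-symmetric, and removing it replaces
  \<open>H'\<close> by \<open>H' - H\<Omega>\<close>, which has to be tangent to \<open>Hr\<close> again. It is, because the curve in \<open>Hr\<close> may be
  multiplied by a curve of orthogonal matrices with velocity \<open>- \<Omega>\<close>. Such a curve is the Cayley transform
  (\<open>orthogonal_curve_ex\<close>). The same construction shows that every \<open>V\<^sub>p\<close> with \<open>V\<^sup>T V\<^sub>p = 0\<close> is tangent to the
  Stiefel manifold, so that every pair \<open>(K, V\<^sub>p)\<close> represents a tangent vector of \<open>Mh\<close>.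
\<close>

section \<open>Calculus of smooth maps\<close>

lemma Ck_on_cong:
  assumes "open S" "\<And>x. x \<in> S \<Longrightarrow> f x = g x" "Ck_on k S f"
  shows "Ck_on k S g"
  using assms(2,3)
proof (induction k arbitrary: f g)
  case 0
  then show ?case by (metis Ck_on.simps(1) continuous_on_cong)
next
  case (Suc k)
  have der: "(g has_derivative frechet_derivative f (at x)) (at x)" if "x \<in> S" for x
  proof -
    have "(f has_derivative frechet_derivative f (at x)) (at x)"
      using Suc.prems(2) that frechet_derivative_works by auto
    then show ?thesis
      using has_derivative_transform_within_open[OF _ assms(1) that] Suc.prems(1) by blast
  qed
  have "Ck_on k S (\<lambda>x. frechet_derivative g (at x) v)" for v
  proof (rule Suc.IH)
    show "frechet_derivative f (at x) v = frechet_derivative g (at x) v" if "x \<in> S" for x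
      using frechet_derivative_at[OF der[OF that]] by simp
    show "Ck_on k S (\<lambda>x. frechet_derivative f (at x) v)" using Suc.prems by simp
  qed
  moreover have "g differentiable (at x)" if "x \<in> S" for x
    using der[OF that] by (rule differentiableI)
  ultimately show ?case unfolding Ck_on.simps by blast
qed

lemma Ck_on_subset: "Ck_on k S f \<Longrightarrow> T \<subseteq> S \<Longrightarrow> Ck_on k T f"
  by (induction k arbitrary: f) (auto intro: continuous_on_subset)

lemma Ck_on_Suc_imp: "Ck_on (Suc k) S f \<Longrightarrow> Ck_on k S f"
proof (induction k arbitrary: f)
  case 0
  then show ?case
    by (simp add: continuous_at_imp_continuous_on differentiable_imp_continuous_within)
next
  case (Suc k)
  then show ?case by (metis Ck_on.simps(2))
qed

text \<open>
  The recursion of \<open>Ck_on\<close> is phrased with \<open>frechet_derivative\<close>, which is awkward to compute with.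
  This is the form used below: any family of derivatives may be supplied.
\<close>

lemma Ck_on_derivative:
  assumes "open S" "\<And>x. x \<in> S \<Longrightarrow> (f has_derivative f' x) (at x)" "\<And>v. Ck_on k S (\<lambda>x. f' x v)"
  shows "Ck_on (Suc k) S f"
proof -
  have "Ck_on k S (\<lambda>x. frechet_derivative f (at x) v)" for v
    by (rule Ck_on_cong[OF assms(1) _ assms(3)[of v]])
       (use frechet_derivative_at[OF assms(2)] in simp)
  moreover have "f differentiable (at x)" if "x \<in> S" for x
    using assms(2)[OF that] by (rule differentiableI)
  ultimately show ?thesis unfolding Ck_on.simps by blast
qed

lemma Ck_on_has_derivative:
  "Ck_on (Suc k) S f \<Longrightarrow> x \<in> S \<Longrightarrow> (f has_derivative frechet_derivative f (at x)) (at x)"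
  by (simp add: frechet_derivative_works)

lemma Ck_on_const: "Ck_on k S (\<lambda>x. c)"
  by (induction k arbitrary: c) (auto simp: frechet_derivative_const)

lemma Ck_on_bounded_linear:
  assumes "bounded_linear L" "open S" "Ck_on k S f"
  shows "Ck_on k S (\<lambda>x. L (f x))"
  using assms(3)
proof (induction k arbitrary: f)
  case 0
  then show ?case using bounded_linear.continuous_on[OF assms(1)] by simp
next
  case (Suc k)
  show ?case
    by (rule Ck_on_derivative[OF assms(2) bounded_linear.has_derivative[OF assms(1) Ck_on_has_derivative[OF Suc.prems]]])
       (use Suc in auto)
qed

lemma Ck_on_Pair:
  assumes "open S" "Ck_on k S f" "Ck_on k S g"
  shows "Ck_on k S (\<lambda>x. (f x, g x))"
  using assms(2,3)
proof (induction k arbitrary: f g)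
  case 0
  then show ?case by (simp add: continuous_on_Pair)
next
  case (Suc k)
  show ?case
    by (rule Ck_on_derivative[OF assms(1) has_derivative_Pair])
       (use Suc in \<open>auto intro: Ck_on_has_derivative\<close>)
qed

text \<open>
  Addition is a linear map applied to a pair, so no induction is needed.
\<close>

lemma Ck_on_add:
  assumes "open S" "Ck_on k S f" "Ck_on k S g"
  shows "Ck_on k S (\<lambda>x. f x + g x)"
  using Ck_on_bounded_linear[OF bounded_linear_add[OF bounded_linear_fst bounded_linear_snd] assms(1) Ck_on_Pair[OF assms]]
  by simp

lemma Ck_on_sum:
  assumes "open S" "\<And>i. i \<in> I \<Longrightarrow> Ck_on k S (f i)"
  shows "Ck_on k S (\<lambda>x. \<Sum>i\<in>I. f i x)"
  using assms(2)
  by (induction I rule: infinite_finite_induct) (auto simp: Ck_on_const intro: Ck_on_add[OF assms(1)])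

lemma Ck_on_bilinear:
  assumes "bounded_bilinear B" "open S" "Ck_on k S f" "Ck_on k S g"
  shows "Ck_on k S (\<lambda>x. B (f x) (g x))"
  using assms(3,4)
proof (induction k arbitrary: f g)
  case 0
  then show ?case using bounded_bilinear.continuous_on[OF assms(1)] by simp
next
  case (Suc k)
  show ?case
  proof (rule Ck_on_derivative[OF assms(2) bounded_bilinear.FDERIV[OF assms(1)]])
    fix v
    show "Ck_on k S (\<lambda>x. B (f x) (frechet_derivative g (at x) v) + B (frechet_derivative f (at x) v) (g x))"
      using Suc.prems Ck_on_Suc_imp[OF Suc.prems(1)] Ck_on_Suc_imp[OF Suc.prems(2)]
      by (intro Ck_on_add assms(2) Suc.IH) auto
  qed (use Suc in \<open>auto intro: Ck_on_has_derivative\<close>)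
qed

text \<open>
  In the induction step the derivative of \<open>g \<circ> f\<close> is expanded in coordinates,
  \<open>D(g \<circ> f)\<^sub>x(v) = (\<Sum>b\<in>Basis. (Df\<^sub>x(v) \<bullet> b) *\<^sub>R Dg\<^bsub>f(x)\<^esub>(b))\<close>. For a fixed direction \<open>b\<close> the map
  \<open>x \<mapsto> Dg\<^bsub>f(x)\<^esub>(b)\<close> is again a composition, to which the induction hypothesis applies; the coefficients are
  covered by the rules for linear maps, products and sums.
\<close>

lemma Ck_on_compose:
  fixes f :: "'a::euclidean_space \<Rightarrow> 'b::euclidean_space" and g :: "'b \<Rightarrow> 'c::real_normed_vector"
  assumes "open S" "Ck_on k S f" "Ck_on k T g" "f ` S \<subseteq> T"
  shows "Ck_on k S (\<lambda>x. g (f x))"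
  using assms(2,3)
proof (induction k arbitrary: g)
  case 0
  then show ?case using assms(4) by (auto intro: continuous_on_compose2)
next
  case (Suc k)
  have df: "(f has_derivative frechet_derivative f (at x)) (at x)" if "x \<in> S" for x
    using Ck_on_has_derivative[OF Suc.prems(1) that] .
  have dg: "(g has_derivative frechet_derivative g (at (f x))) (at (f x))" if "x \<in> S" for x
    using Ck_on_has_derivative[OF Suc.prems(2)] that assms(4) by auto
  have expand: "(\<Sum>b\<in>Basis. (v \<bullet> b) *\<^sub>R frechet_derivative g (at (f x)) b) = frechet_derivative g (at (f x)) v"
    if "x \<in> S" for x v
  proof -
    interpret linear "frechet_derivative g (at (f x))"
      using has_derivative_linear[OF dg[OF that]] .
    show ?thesis
      by (metis (no_types, lifting) euclidean_representation scale sum sum.cong)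
  qed
  show ?case
  proof (rule Ck_on_derivative[OF assms(1)])
    fix x assume "x \<in> S"
    show "((\<lambda>x. g (f x)) has_derivative
        (\<lambda>v. \<Sum>b\<in>Basis. (frechet_derivative f (at x) v \<bullet> b) *\<^sub>R frechet_derivative g (at (f x)) b)) (at x)"
      using has_derivative_compose[OF df dg, OF \<open>x \<in> S\<close> \<open>x \<in> S\<close>] by (simp add: expand \<open>x \<in> S\<close>)
  next
    fix v
    have "Ck_on k S (\<lambda>x. frechet_derivative g (at (f x)) b)" for b
      using Suc.prems Ck_on_Suc_imp by (intro Suc.IH) auto
    moreover have "Ck_on k S (\<lambda>x. frechet_derivative f (at x) v \<bullet> b)" for b
      using Suc.prems by (intro Ck_on_bounded_linear[OF bounded_linear_inner_left] assms(1)) auto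
    ultimately show "Ck_on k S (\<lambda>x. \<Sum>b\<in>Basis. (frechet_derivative f (at x) v \<bullet> b) *\<^sub>R frechet_derivative g (at (f x)) b)"
      by (intro Ck_on_sum Ck_on_bilinear[OF bounded_bilinear_scaleR] assms(1))
  qed
qed

lemma smooth_on_subset: "smooth_on S f \<Longrightarrow> T \<subseteq> S \<Longrightarrow> smooth_on T f"
  by (auto simp: smooth_on_def intro: Ck_on_subset)

lemma smooth_on_const: "smooth_on S (\<lambda>x. c)"
  by (simp add: smooth_on_def Ck_on_const)

lemma smooth_on_continuous_on: "smooth_on S f \<Longrightarrow> continuous_on S f"
  unfolding smooth_on_def by (metis Ck_on.simps(1))

lemma smooth_on_differentiable: "smooth_on S f \<Longrightarrow> x \<in> S \<Longrightarrow> f differentiable (at x)"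
  unfolding smooth_on_def by (metis Ck_on.simps(2))

lemma smooth_on_linear:
  fixes L :: "'b::euclidean_space \<Rightarrow> 'c::real_normed_vector"
  assumes "linear L" "open S" "smooth_on S f"
  shows "smooth_on S (\<lambda>x. L (f x))"
  using assms unfolding linear_conv_bounded_linear smooth_on_def by (auto intro: Ck_on_bounded_linear)

lemma smooth_on_id:
  assumes "open S" shows "smooth_on S (\<lambda>x. x)"
proof -
  have "Ck_on k S (\<lambda>x. x)" for k
  proof (cases k)
    case (Suc j)
    then show ?thesis using assms Ck_on_const by (auto intro!: Ck_on_derivative)
  qed simp
  then show ?thesis by (simp add: smooth_on_def)
qed

lemma linear_imp_smooth_on:
  fixes L :: "'a::euclidean_space \<Rightarrow> 'b::real_normed_vector"
  shows "linear L \<Longrightarrow> open S \<Longrightarrow> smooth_on S L"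
  using smooth_on_linear[OF _ _ smooth_on_id] by blast

lemma smooth_on_Pair:
  "open S \<Longrightarrow> smooth_on S f \<Longrightarrow> smooth_on S g \<Longrightarrow> smooth_on S (\<lambda>x. (f x, g x))"
  by (auto simp: smooth_on_def intro: Ck_on_Pair)

lemma smooth_on_sum:
  "open S \<Longrightarrow> (\<And>i. i \<in> I \<Longrightarrow> smooth_on S (f i)) \<Longrightarrow> smooth_on S (\<lambda>x. \<Sum>i\<in>I. f i x)"
  by (auto simp: smooth_on_def intro: Ck_on_sum)

lemma smooth_on_bilinear:
  "bounded_bilinear B \<Longrightarrow> open S \<Longrightarrow> smooth_on S f \<Longrightarrow> smooth_on S g \<Longrightarrow> smooth_on S (\<lambda>x. B (f x) (g x))"
  by (auto simp: smooth_on_def intro: Ck_on_bilinear)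

lemma smooth_on_add:
  "open S \<Longrightarrow> smooth_on S f \<Longrightarrow> smooth_on S g \<Longrightarrow> smooth_on S (\<lambda>x. f x + g x)"
  by (auto simp: smooth_on_def intro: Ck_on_add)

lemma smooth_on_diff:
  fixes f :: "'a::euclidean_space \<Rightarrow> 'b::euclidean_space"
  assumes "open S" "smooth_on S f" "smooth_on S g"
  shows "smooth_on S (\<lambda>x. f x - g x)"
  using smooth_on_add[OF assms(1,2) smooth_on_linear[OF _ assms(1,3), of uminus]]
  by (simp add: linear_iff)

lemma smooth_on_compose:
  fixes f :: "'a::euclidean_space \<Rightarrow> 'b::euclidean_space" and g :: "'b \<Rightarrow> 'c::real_normed_vector"
  shows "open S \<Longrightarrow> smooth_on S f \<Longrightarrow> smooth_on T g \<Longrightarrow> f ` S \<subseteq> T \<Longrightarrow> smooth_on S (\<lambda>x. g (f x))"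
  by (auto simp: smooth_on_def intro: Ck_on_compose)

text \<open>
  Bootstrapping: if the derivative of a curve can be written in terms of the curve itself, each order of
  differentiability of the curve gives the next one. Both functions for which smoothness is not a formal
  consequence of the rules above, the inverse square root and the inverse of the matrix \<open>I - tB\<close>, satisfy such an equation.
\<close>

lemma smooth_on_ODE:
  fixes f f' :: "real \<Rightarrow> 'b::real_normed_vector"
  assumes "open S" "\<And>x. x \<in> S \<Longrightarrow> (f has_vector_derivative f' x) (at x)"
    and "\<And>k. Ck_on k S f \<Longrightarrow> Ck_on k S f'"
  shows "smooth_on S f"
proof -
  have "Ck_on k S f" for k
  proof (induction k)
    case 0
    have "isCont f x" if "x \<in> S" for x
      using assms(2)[OF that] has_vector_derivative_continuous by blast
    then show ?case by (simp add: continuous_at_imp_continuous_on)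
  next
    case (Suc k)
    show ?case
      by (rule Ck_on_derivative[OF assms(1) assms(2)[unfolded has_vector_derivative_def]])
         (use assms(3)[OF Suc] in \<open>auto intro: Ck_on_bounded_linear[OF bounded_linear_scaleR_right] assms(1)\<close>)
  qed
  then show ?thesis by (simp add: smooth_on_def)
qed

text \<open>
  The function \<open>g(x) = 1 / sqrt x\<close> satisfies \<open>g' = - g\<^sup>3 / 2\<close>.
\<close>

lemma smooth_on_inverse_sqrt: "smooth_on {0<..} (\<lambda>x::real. inverse (sqrt x))"
proof (rule smooth_on_ODE)
  let ?g = "\<lambda>x::real. inverse (sqrt x)"
  show "(?g has_vector_derivative - (?g x * (?g x * ?g x)) / 2) (at x)" if "x \<in> {0<..}" for x
    using that
    by (auto intro!: derivative_eq_intros simp: has_real_derivative_iff_has_vector_derivative[symmetric] field_simps power2_eq_square)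
  show "Ck_on k {0<..} (\<lambda>x. - (?g x * (?g x * ?g x)) / 2)" if "Ck_on k {0<..} ?g" for k
  proof -
    have "Ck_on k {0<..} (\<lambda>x. ?g x * (?g x * ?g x))"
      by (intro Ck_on_bilinear[OF bounded_bilinear_mult] that open_greaterThan)
    then have "Ck_on k {0<..} (\<lambda>x. (- 1 / 2) * (?g x * (?g x * ?g x)))"
      by (rule Ck_on_bounded_linear[OF bounded_linear_mult_right open_greaterThan])
    then show ?thesis by simp
  qed
qed auto

lemma smooth_on_normalize:
  fixes f :: "'a::euclidean_space \<Rightarrow> 'b::euclidean_space"
  assumes "open S" "smooth_on S f" "\<And>x. x \<in> S \<Longrightarrow> f x \<noteq> 0"
  shows "smooth_on S (\<lambda>x. f x /\<^sub>R norm (f x))"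
proof -
  have "smooth_on S (\<lambda>x. f x \<bullet> f x)"
    using assms by (intro smooth_on_bilinear[OF bounded_bilinear_inner])
  then have "smooth_on S (\<lambda>x. inverse (sqrt (f x \<bullet> f x)))"
    using assms by (intro smooth_on_compose[OF _ _ smooth_on_inverse_sqrt]) auto
  then have "smooth_on S (\<lambda>x. inverse (sqrt (f x \<bullet> f x)) *\<^sub>R f x)"
    using assms by (intro smooth_on_bilinear[OF bounded_bilinear_scaleR])
  then show ?thesis by (simp add: norm_eq_sqrt_inner)
qed

lemma smooth_on_imp_smooth_map_on:
  "open U \<Longrightarrow> smooth_on U f \<Longrightarrow> M \<subseteq> U \<Longrightarrow> smooth_map_on M f"
  unfolding smooth_map_on_def by blast

lemma smooth_map_on_compose:
  fixes f :: "'a::euclidean_space \<Rightarrow> 'b::euclidean_space" and g :: "'b \<Rightarrow> 'c::real_normed_vector"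
  assumes f: "smooth_map_on M f" and g: "smooth_map_on N g" and sub: "f ` M \<subseteq> N"
  shows "smooth_map_on M (\<lambda>x. g (f x))"
  unfolding smooth_map_on_def
proof
  fix x assume x: "x \<in> M"
  obtain U F where U: "open U" "x \<in> U" "smooth_on U F" "\<And>y. y \<in> U \<inter> M \<Longrightarrow> F y = f y"
    using f x unfolding smooth_map_on_def by metis
  obtain V G where V: "open V" "f x \<in> V" "smooth_on V G" "\<And>y. y \<in> V \<inter> N \<Longrightarrow> G y = g y"
    using g x sub unfolding smooth_map_on_def by (metis image_subset_iff)
  let ?W = "U \<inter> F -` V"
  have O: "open ?W"
    using continuous_open_preimage[OF smooth_on_continuous_on[OF U(3)] U(1) V(1)] .
  have "smooth_on ?W (\<lambda>y. G (F y))"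
    using O by (intro smooth_on_compose[OF O smooth_on_subset[OF U(3)] V(3)]) auto
  moreover have "x \<in> ?W" using x U V by auto
  moreover have "\<forall>y\<in>?W \<inter> M. G (F y) = g (f y)"
    using U(4) V(4) sub by force
  ultimately show "\<exists>U F. open U \<and> x \<in> U \<and> smooth_on U F \<and> (\<forall>y\<in>U \<inter> M. F y = g (f y))"
    using O by (intro exI[of _ ?W] exI[of _ "\<lambda>y. G (F y)"]) auto
qed

lemma smooth_map_on_cong:
  "(\<And>x. x \<in> M \<Longrightarrow> f x = g x) \<Longrightarrow> smooth_map_on M f \<Longrightarrow> smooth_map_on M g"
  unfolding smooth_map_on_def by (metis IntD2)

text \<open>
  Smoothness of a map defined by choosing representations is only visible near each point, where the
  choice can be made smoothly; this lemma passes from there to the whole domain.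
\<close>

lemma smooth_map_on_local:
  assumes "\<And>x. x \<in> M \<Longrightarrow> \<exists>W. open W \<and> x \<in> W \<and> smooth_map_on (M \<inter> W) f"
  shows "smooth_map_on M f"
  unfolding smooth_map_on_def
proof
  fix x assume x: "x \<in> M"
  obtain W where W: "open W" "x \<in> W" "smooth_map_on (M \<inter> W) f" using assms[OF x] by blast
  obtain U F where U: "open U" "x \<in> U" "smooth_on U F" "\<And>y. y \<in> U \<inter> (M \<inter> W) \<Longrightarrow> F y = f y"
    using W x unfolding smooth_map_on_def by (metis IntI)
  show "\<exists>U F. open U \<and> x \<in> U \<and> smooth_on U F \<and> (\<forall>y\<in>U \<inter> M. F y = f y)"
    by (rule exI[of _ "U \<inter> W"], rule exI[of _ F])
       (use W U in \<open>auto intro: smooth_on_subset\<close>)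
qed

lemma smooth_map_on_Pair:
  assumes f: "smooth_map_on M f" and g: "smooth_map_on M g"
  shows "smooth_map_on M (\<lambda>x. (f x, g x))"
  unfolding smooth_map_on_def
proof
  fix x assume x: "x \<in> M"
  obtain U F where U: "open U" "x \<in> U" "smooth_on U F" "\<And>y. y \<in> U \<inter> M \<Longrightarrow> F y = f y"
    using f x unfolding smooth_map_on_def by metis
  obtain V G where V: "open V" "x \<in> V" "smooth_on V G" "\<And>y. y \<in> V \<inter> M \<Longrightarrow> G y = g y"
    using g x unfolding smooth_map_on_def by metis
  have o: "open (U \<inter> V)" using U V by auto
  then have s: "smooth_on (U \<inter> V) (\<lambda>y. (F y, G y))"
    using U V by (intro smooth_on_Pair) (auto intro: smooth_on_subset)
  show "\<exists>U h. open U \<and> x \<in> U \<and> smooth_on U h \<and> (\<forall>y\<in>U \<inter> M. h y = (f y, g y))"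
    by (rule exI[of _ "U \<inter> V"], rule exI[of _ "\<lambda>y. (F y, G y)"]) (use o s U(2,4) V(2,4) in simp)
qed

lemma smooth_map_on_linear:
  fixes L :: "'b::euclidean_space \<Rightarrow> 'c::real_normed_vector"
  assumes "linear L" "smooth_map_on M f"
  shows "smooth_map_on M (\<lambda>x. L (f x))"
proof (rule smooth_map_on_compose[OF assms(2)])
  show "smooth_map_on UNIV L"
    using assms(1) by (auto intro!: smooth_on_imp_smooth_map_on[of UNIV] linear_imp_smooth_on)
qed simp

lemma smooth_map_on_bilinear:
  fixes B :: "'b::euclidean_space \<Rightarrow> 'c::euclidean_space \<Rightarrow> 'd::real_normed_vector"
  assumes "bounded_bilinear B" "smooth_map_on M f" "smooth_map_on M g"
  shows "smooth_map_on M (\<lambda>x. B (f x) (g x))"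
proof -
  have "smooth_on UNIV (\<lambda>z. B (fst z) (snd z))"
    by (intro smooth_on_bilinear[OF assms(1)] open_UNIV linear_imp_smooth_on linear_fst linear_snd)
  then have "smooth_map_on UNIV (\<lambda>z. B (fst z) (snd z))"
    by (rule smooth_on_imp_smooth_map_on[OF open_UNIV]) simp
  from smooth_map_on_compose[OF smooth_map_on_Pair[OF assms(2,3)] this] show ?thesis
    by simp
qed

lemma smooth_map_on_id: "smooth_map_on N (\<lambda>z. z)"
  by (rule smooth_on_imp_smooth_map_on[OF open_UNIV smooth_on_id]) auto

section \<open>Tangent vectors as velocities of curves\<close>

lemma open_contains_interval:
  fixes S :: "real set" assumes "open S" "0 \<in> S" obtains e where "0 < e" "{-e<..<e} \<subseteq> S"
proof -
  obtain e where "0 < e" "ball 0 e \<subseteq> S" using assms openE by blast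
  then show ?thesis using that[of e] by (auto simp: ball_eq_greaterThanLessThan)
qed

text \<open>
  The domain of the curve may be any open neighbourhood of \<open>0\<close>. This is convenient because the curves below
  live on preimages of open sets.
\<close>

lemma tangent_spaceI:
  assumes "open S" "0 \<in> S" "smooth_on S c" "\<And>t. t \<in> S \<Longrightarrow> c t \<in> M" "c 0 = x"
    and "(c has_vector_derivative v) (at (0::real))"
  shows "v \<in> tangent_space M x"
proof -
  obtain e where e: "0 < e" "{-e<..<e} \<subseteq> S" using open_contains_interval[OF assms(1,2)] .
  then show ?thesis
    using assms by (auto simp: tangent_space_def intro!: exI[of _ c] exI[of _ e] intro: smooth_on_subset)
qed

lemma tangent_spaceE:
  assumes "v \<in> tangent_space M x"
  obtains c S where "open S" "0 \<in> S" "smooth_on S c" "\<And>t. t \<in> S \<Longrightarrow> c t \<in> M" "c 0 = x"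
    "(c has_vector_derivative v) (at (0::real))"
proof -
  obtain c e where "0 < e" "smooth_on {-e<..<e} c" "\<And>t. t \<in> {-e<..<e} \<Longrightarrow> c t \<in> M" "c 0 = x"
    "(c has_vector_derivative v) (at (0::real))"
    using assms by (auto simp: tangent_space_def)
  then show ?thesis by (intro that[of "{-e<..<e}" c]) auto
qed

lemma tangent_space_zero: "x \<in> M \<Longrightarrow> 0 \<in> tangent_space M x"
  by (rule tangent_spaceI[of UNIV "\<lambda>t. x"]) (auto simp: smooth_on_const)

lemma tangent_space_scaleR:
  assumes "v \<in> tangent_space M x" shows "a *\<^sub>R v \<in> tangent_space M x"
proof -
  obtain c S where c: "open S" "0 \<in> S" "smooth_on S c" "\<And>t. t \<in> S \<Longrightarrow> c t \<in> M" "c 0 = x"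
    "(c has_vector_derivative v) (at (0::real))"
    using tangent_spaceE[OF assms] by metis
  let ?S = "(\<lambda>t. a * t) -` S"
  have o: "open ?S" by (intro open_vimage c continuous_intros)
  show ?thesis
  proof (rule tangent_spaceI[OF o])
    show "smooth_on ?S (\<lambda>t. c (a * t))"
      by (rule smooth_on_compose[OF o linear_imp_smooth_on[OF linear_times o] c(3)]) auto
    show "((\<lambda>t. c (a * t)) has_vector_derivative a *\<^sub>R v) (at 0)"
    proof -
      have "((*) a has_vector_derivative a) (at 0)"
        by (auto intro!: derivative_eq_intros simp: has_real_derivative_iff_has_vector_derivative[symmetric])
      then show ?thesis
        using vector_diff_chain_at[of "(*) a" a 0 c v] c(6) by (simp add: o_def)
    qed
  qed (use c in auto)
qed

section \<open>Curves of orthogonal matrices with prescribed velocity\<close>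

lemma bounded_bilinear_matrix_mult:
  "bounded_bilinear ((**) :: real^'n^'m \<Rightarrow> real^'p^'n \<Rightarrow> real^'p^'m)"
  unfolding bilinear_conv_bounded_bilinear[symmetric] bilinear_def linear_iff
  by (auto simp: matrix_matrix_mult_def vec_eq_iff algebra_simps sum.distrib sum_distrib_left)

lemmas matrix_mult_distribs =
  bounded_bilinear.add_left[OF bounded_bilinear_matrix_mult]
  bounded_bilinear.add_right[OF bounded_bilinear_matrix_mult]
  bounded_bilinear.diff_left[OF bounded_bilinear_matrix_mult]
  bounded_bilinear.diff_right[OF bounded_bilinear_matrix_mult]
  bounded_bilinear.minus_left[OF bounded_bilinear_matrix_mult]
  bounded_bilinear.minus_right[OF bounded_bilinear_matrix_mult]
  bounded_bilinear.scaleR_left[OF bounded_bilinear_matrix_mult]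
  bounded_bilinear.scaleR_right[OF bounded_bilinear_matrix_mult]

lemma linear_transpose: "linear (transpose :: real^'n^'m \<Rightarrow> real^'m^'n)"
  by (simp add: linear_iff transpose_def vec_eq_iff)

lemmas transpose_simps =
  linear_add[OF linear_transpose] linear_diff[OF linear_transpose]
  linear_neg[OF linear_transpose] linear_scale[OF linear_transpose]
  linear_0[OF linear_transpose] matrix_transpose_mul

lemma matrix_mult_inner: 
  fixes A :: "real^'n^'m" shows "(A ** X) \<bullet> Y = X \<bullet> (transpose A ** Y)"
proof -
  have "(A ** X) \<bullet> Y = (\<Sum>i\<in>UNIV. \<Sum>j\<in>UNIV. \<Sum>k\<in>UNIV. A$i$k * X$k$j * Y$i$j)"
    by (simp add: inner_vec_def matrix_matrix_mult_def sum_distrib_right)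
  also have "\<dots> = (\<Sum>i\<in>UNIV. \<Sum>k\<in>UNIV. \<Sum>j\<in>UNIV. A$i$k * X$k$j * Y$i$j)"
    by (intro sum.cong refl sum.swap)
  also have "\<dots> = (\<Sum>k\<in>UNIV. \<Sum>i\<in>UNIV. \<Sum>j\<in>UNIV. A$i$k * X$k$j * Y$i$j)"
    by (rule sum.swap)
  also have "\<dots> = (\<Sum>k\<in>UNIV. \<Sum>j\<in>UNIV. \<Sum>i\<in>UNIV. A$i$k * X$k$j * Y$i$j)"
    by (intro sum.cong refl sum.swap)
  also have "\<dots> = X \<bullet> (transpose A ** Y)"
    by (simp add: inner_vec_def matrix_matrix_mult_def transpose_def sum_distrib_left ac_simps)
  finally show ?thesis .
qed

text \<open>
  Multiplication by a skew-symmetric \<open>B\<close> moves \<open>X\<close> in a direction orthogonal to \<open>X\<close>, so by Pythagoras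
  \<open>\<bar>X - tBX\<bar>\<^sup>2 = \<bar>X\<bar>\<^sup>2 + t\<^sup>2 \<bar>BX\<bar>\<^sup>2\<close>. The norm is the Frobenius norm of matrices.
\<close>

lemma norm_skew_resolvent:
  fixes B :: "real^'n^'n" and X :: "real^'p^'n"
  assumes skew: "transpose B = - B"
  shows "norm X \<le> norm ((mat 1 - t *\<^sub>R B) ** X)"
proof -
  have "X \<bullet> (B ** X) = 0"
    using matrix_mult_inner[of B X X] by (simp add: skew matrix_mult_distribs inner_commute)
  then have "((mat 1 - t *\<^sub>R B) ** X) \<bullet> ((mat 1 - t *\<^sub>R B) ** X) = X \<bullet> X + t\<^sup>2 * ((B ** X) \<bullet> (B ** X))"
    by (simp add: matrix_mult_distribs inner_diff_left inner_diff_right inner_commute power2_eq_square)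
  then show ?thesis by (simp add: norm_le)
qed

text \<open>
  By the preceding estimate \<open>I - tB\<close> is injective, hence invertible, and its inverse \<open>g(t)\<close> has operator norm at most \<open>1\<close>. The
  identity \<open>g(s) - g(t) = (s - t) g(s) B g(t)\<close> then gives continuity and, after that, the differential
  equation \<open>g' = g B g\<close>, from which smoothness follows.
\<close>

lemma skew_resolvent_ex:
  fixes B :: "real^'n^'n"
  assumes skew: "transpose B = - B"
  obtains g :: "real \<Rightarrow> real^'n^'n" where "smooth_on UNIV g"
    "\<And>t. (mat 1 - t *\<^sub>R B) ** g t = mat 1" "\<And>t. g t ** (mat 1 - t *\<^sub>R B) = mat 1"
    "\<And>t. (g has_vector_derivative g t ** (B ** g t)) (at t)"
proof -
  define M where "M t = mat 1 - t *\<^sub>R B" for t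
  have "\<exists>g. M t ** g = mat 1" for t
  proof -
    have lin: "linear (\<lambda>X :: real^'n^'n. M t ** X)"
      using bounded_bilinear.bounded_linear_right[OF bounded_bilinear_matrix_mult] bounded_linear.linear by blast
    moreover have "inj (\<lambda>X :: real^'n^'n. M t ** X)"
    proof (subst linear_injective_0[OF lin], intro allI impI)
      fix X assume "M t ** X = 0"
      then show "X = 0" using norm_skew_resolvent[OF skew, of X t] by (simp add: M_def)
    qed
    ultimately have "surj (\<lambda>X :: real^'n^'n. M t ** X)" by (rule linear_injective_imp_surjective) simp
    then show ?thesis by (metis surjD)
  qed
  then obtain g where r: "\<And>t. M t ** g t = mat 1" by metis
  then have l: "g t ** M t = mat 1" for t using matrix_left_right_inverse by blast
  have bound: "norm (g t ** X) \<le> norm X" for t and X :: "real^'n^'n"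
    using norm_skew_resolvent[OF skew, of "g t ** X" t] r[of t] by (simp add: M_def matrix_mul_assoc)
  have diff: "g s - g t = (s - t) *\<^sub>R (g s ** (B ** g t))" for s t
  proof -
    have "g s - g t = g s ** ((M t - M s) ** g t)"
      using r[of t] l[of s] by (simp add: matrix_mult_distribs matrix_mul_assoc)
    also have "M t - M s = (s - t) *\<^sub>R B" by (simp add: M_def algebra_simps)
    finally show ?thesis by (simp add: matrix_mult_distribs)
  qed
  have cont: "(g \<longlongrightarrow> g t) (at t)" for t
  proof -
    have "\<forall>\<^sub>F s in at t. norm (g s - g t) \<le> \<bar>s - t\<bar> * norm (B ** g t)"
      using bound by (intro always_eventually) (simp add: diff mult_left_mono)
    moreover have "((\<lambda>s. \<bar>s - t\<bar> * norm (B ** g t)) \<longlongrightarrow> 0) (at t)"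
      by (auto intro!: tendsto_eq_intros)
    ultimately have "((\<lambda>s. g s - g t) \<longlongrightarrow> 0) (at t)" by (rule Lim_null_comparison)
    then show ?thesis by (rule LIM_zero_cancel)
  qed
  have der: "(g has_vector_derivative g t ** (B ** g t)) (at t)" for t
    unfolding has_vector_derivative_def has_derivative_iff_norm
  proof
    have "((\<lambda>s. norm ((g s - g t) ** (B ** g t))) \<longlongrightarrow> norm ((g t - g t) ** (B ** g t))) (at t)"
      by (intro tendsto_norm bounded_bilinear.tendsto[OF bounded_bilinear_matrix_mult] tendsto_intros cont)
    moreover have "norm (g s - g t - (s - t) *\<^sub>R (g t ** (B ** g t))) / norm (s - t) = norm ((g s - g t) ** (B ** g t))"
      if "s \<noteq> t" for s
    proof -
      have "g s - g t - (s - t) *\<^sub>R (g t ** (B ** g t)) = (s - t) *\<^sub>R ((g s - g t) ** (B ** g t))"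
        by (subst diff) (simp only: scaleR_diff_right[symmetric] bounded_bilinear.diff_left[OF bounded_bilinear_matrix_mult, symmetric])
      then show ?thesis using that by simp
    qed
    ultimately show "((\<lambda>s. norm (g s - g t - (s - t) *\<^sub>R (g t ** (B ** g t))) / norm (s - t)) \<longlongrightarrow> 0) (at t)"
      by (simp cong: Lim_cong_within)
  qed (rule bounded_linear_scaleR_left)
  have "smooth_on UNIV g"
    by (rule smooth_on_ODE[OF open_UNIV der])
       (auto intro!: Ck_on_bilinear[OF bounded_bilinear_matrix_mult] Ck_on_const)
  with r l der show thesis using that unfolding M_def by blast
qed

text \<open>
  The Cayley transform \<open>Q(t) = (I + tB)(I - tB)\<^sup>-\<^sup>1\<close> is orthogonal for skew-symmetric \<open>B\<close>, because the two
  factors commute and transposition interchanges them. Its velocity at \<open>0\<close> is \<open>2B\<close>, whence \<open>B = A/2\<close>.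
\<close>

lemma orthogonal_curve_ex:
  fixes A :: "real^'n^'n"
  assumes skew: "transpose A = - A"
  obtains Q :: "real \<Rightarrow> real^'n^'n" where "smooth_on UNIV Q" "\<And>t. orthogonal_matrix (Q t)"
    "Q 0 = mat 1" "(Q has_vector_derivative A) (at 0)"
proof -
  define B where "B = A /\<^sub>R 2"
  have skewB: "transpose B = - B" using skew by (simp add: B_def transpose_simps)
  obtain g where g: "smooth_on UNIV g"
    "\<And>t. (mat 1 - t *\<^sub>R B) ** g t = mat 1" "\<And>t. g t ** (mat 1 - t *\<^sub>R B) = mat 1"
    "\<And>t. (g has_vector_derivative g t ** (B ** g t)) (at t)"
    using skew_resolvent_ex[OF skewB] by metis
  define Q where "Q t = (mat 1 + t *\<^sub>R B) ** g t" for t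
  have g0: "g 0 = mat 1" using g(2)[of 0] by simp
  have N: "smooth_on UNIV (\<lambda>t. mat 1 + t *\<^sub>R B)"
    by (intro smooth_on_add smooth_on_const linear_imp_smooth_on) (auto simp: linear_iff scaleR_left_distrib)
  have Nd: "((\<lambda>t. mat 1 + t *\<^sub>R B) has_vector_derivative B) (at 0)"
    by (auto intro!: derivative_eq_intros)
  show thesis
  proof
    show "smooth_on UNIV Q" unfolding Q_def
      by (intro smooth_on_bilinear[OF bounded_bilinear_matrix_mult] open_UNIV N g)
    show "Q 0 = mat 1" by (simp add: Q_def g0)
    have "(Q has_vector_derivative (mat 1 + 0 *\<^sub>R B) ** (g 0 ** (B ** g 0)) + B ** g 0) (at 0)"
      unfolding Q_def
      by (rule bounded_bilinear.has_vector_derivative[OF bounded_bilinear_matrix_mult Nd g(4)])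
    moreover have "B + B = A" by (simp add: B_def vec_eq_iff)
    ultimately show "(Q has_vector_derivative A) (at 0)" by (simp add: g0)
    fix t
    let ?M = "mat 1 - t *\<^sub>R B" and ?N = "mat 1 + t *\<^sub>R B"
    have T: "transpose ?N = ?M" "transpose ?M = ?N" by (simp_all add: transpose_simps skewB)
    have "?M ** ?N = ?N ** ?M" by (simp add: matrix_mult_distribs vec_eq_iff algebra_simps)
    then have "transpose (Q t) ** Q t = transpose (g t) ** (?N ** (?M ** g t))"
      by (simp add: Q_def transpose_simps(6) T matrix_mul_assoc) (metis matrix_mul_assoc)
    also have "\<dots> = transpose (?M ** g t)" by (simp only: matrix_transpose_mul T) (simp only: g(2) matrix_mul_rid)
    finally show "orthogonal_matrix (Q t)" by (simp add: orthogonal_matrix g(2))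
  qed
qed

section \<open>Projections and orthonormal frames\<close>

text \<open>
  For a symmetric idempotent \<open>P\<close> the range of \<open>I - P\<close> is the orthogonal complement of the range of \<open>P\<close>.
\<close>

lemma rank_complementary_projection:
  fixes P :: "real^'n^'n"
  assumes sym: "transpose P = P" and idem: "P ** P = P"
  shows "rank (mat 1 - P) = CARD('n) - rank P"
proof -
  have dot: "(P *v x) \<bullet> y = x \<bullet> (P *v y)" for x y
    by (metis dot_lmul_matrix sym vector_transpose_matrix)
  have PP: "P *v (P *v x) = P *v x" for x by (simp add: matrix_vector_mul_assoc idem)
  have "range (\<lambda>x. (mat 1 - P) *v x) = {y \<in> UNIV. \<forall>x\<in>range (\<lambda>x. P *v x). orthogonal x y}"
  proof (intro equalityI subsetI)
    fix y assume "y \<in> range (\<lambda>x. (mat 1 - P) *v x)"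
    then show "y \<in> {y \<in> UNIV. \<forall>x\<in>range (\<lambda>x. P *v x). orthogonal x y}"
      by (auto simp: orthogonal_def dot matrix_vector_mult_diff_rdistrib matrix_vector_mult_diff_distrib PP)
  next
    fix y assume "y \<in> {y \<in> UNIV. \<forall>x\<in>range (\<lambda>x. P *v x). orthogonal x y}"
    then have "(P *v y) \<bullet> y = 0" by (auto simp: orthogonal_def)
    then have "(P *v y) \<bullet> (P *v y) = 0" using dot[of y "P *v y"] by (simp add: PP inner_commute)
    then have "y = (mat 1 - P) *v y" by (simp add: matrix_vector_mult_diff_rdistrib)
    then show "y \<in> range (\<lambda>x. (mat 1 - P) *v x)" by blast
  qed
  moreover have "dim {y \<in> UNIV. \<forall>x\<in>range (\<lambda>x. P *v x). orthogonal x y} + dim (range (\<lambda>x. P *v x)) = dim (UNIV :: (real^'n) set)"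
    by (rule dim_subspace_orthogonal_to_vectors) (auto intro: linear_subspace_image)
  ultimately show ?thesis by (simp add: rank_dim_range)
qed

lemma Stiefel_iff: "V \<in> Stiefel \<longleftrightarrow> transpose V ** V = mat 1"
  by (simp add: Stiefel_def)

lemma Stiefel_cancel:
  assumes "V \<in> Stiefel" shows "A ** transpose V ** V = A" "transpose V ** (V ** B) = B"
  using assms by (simp_all add: Stiefel_iff matrix_mul_assoc[symmetric]) (simp add: matrix_mul_assoc)

lemma Stiefel_projection:
  fixes V :: "real^'r^'n"
  assumes V: "V \<in> Stiefel"
  shows "transpose (V ** transpose V) = V ** transpose V"
    and "(V ** transpose V) ** (V ** transpose V) = V ** transpose V"
    and "rank (V ** transpose V) = CARD('r)"
proof -
  show "transpose (V ** transpose V) = V ** transpose V" by (simp add: transpose_simps)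
  show "(V ** transpose V) ** (V ** transpose V) = V ** transpose V"
    by (simp add: matrix_mul_assoc Stiefel_cancel[OF V])
  have "CARD('r) \<le> rank V"
    using V rank_mul_le_right[of "transpose V" V] by (simp add: Stiefel_iff rank_I)
  moreover have "rank V \<le> rank (V ** transpose V)"
    using rank_mul_le_left[of "V ** transpose V" V] by (simp add: Stiefel_cancel[OF V])
  moreover have "rank (V ** transpose V) \<le> CARD('r)"
    using rank_mul_le_left[of V "transpose V"] rank_bound[of V] by simp
  ultimately show "rank (V ** transpose V) = CARD('r)" by simp
qed

lemma Stiefel_Grassmann:
  fixes V :: "real^'r^'n"
  assumes V: "V \<in> Stiefel"
  shows "mat 1 - V ** transpose V \<in> Grassmann (CARD('n) - CARD('r))"
  using Stiefel_projection[OF V] rank_complementary_projection[OF Stiefel_projection(1,2)[OF V]]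
  by (simp add: Grassmann_def transpose_simps(1-5) matrix_mult_distribs)

text \<open>
  The columns of \<open>V\<close> lie in the range of \<open>P\<close>, so the range of \<open>VV\<^sup>T\<close> is contained in that of \<open>P\<close>, and
  equality follows by comparing dimensions. Hence \<open>VV\<^sup>T P = P\<close>, while the transpose of \<open>PV = V\<close>
  gives \<open>VV\<^sup>T P = VV\<^sup>T\<close>.
\<close>

lemma projection_eq_Stiefel:
  fixes P :: "real^'n^'n" and V :: "real^'r^'n"
  assumes sym: "transpose P = P" and rank: "rank P = CARD('r)"
    and V: "V \<in> Stiefel" and PV: "P ** V = V"
  shows "P = V ** transpose V"
proof -
  let ?S = "range (\<lambda>x. (V ** transpose V) *v x)"
  have "?S \<subseteq> range (\<lambda>x. P *v x)"
    by (metis (no_types, lifting) PV image_subset_iff matrix_mul_assoc matrix_vector_mul_assoc rangeI)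
  moreover have "dim (range (\<lambda>x. P *v x)) \<le> dim ?S"
    using rank Stiefel_projection(3)[OF V] by (simp add: rank_dim_range)
  moreover have "subspace ?S" "subspace (range (\<lambda>x. P *v x))" by (auto intro: linear_subspace_image)
  ultimately have S: "?S = range (\<lambda>x. P *v x)" by (metis subspace_dim_equal)
  have "(V ** transpose V) ** P = P"
  proof (subst matrix_eq, intro allI)
    fix x
    obtain y where "P *v x = (V ** transpose V) *v y" using S by (metis rangeE rangeI)
    then show "(V ** transpose V ** P) *v x = P *v x"
      by (metis Stiefel_projection(2)[OF V] matrix_vector_mul_assoc)
  qed
  moreover have "(V ** transpose V) ** P = V ** transpose V"
    by (metis PV matrix_mul_assoc matrix_transpose_mul sym)
  ultimately show ?thesis by simp
qed

definition of_columns :: "('r \<Rightarrow> real^'n) \<Rightarrow> real^'r^'n" where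
  "of_columns f = (\<chi> a j. f j $ a)"

lemma column_of_columns [simp]: "column j (of_columns f) = f j"
  by (simp add: of_columns_def column_def vec_eq_iff)

lemma of_columns_column: "of_columns (\<lambda>j. column j V) = V"
  by (simp add: of_columns_def column_def vec_eq_iff)

lemma of_columns_Stiefel:
  "of_columns f \<in> Stiefel \<longleftrightarrow> (\<forall>i j. f i \<bullet> f j = (if i = j then 1 else 0))"
  by (auto simp: Stiefel_iff matrix_mult_transpose_dot_column vec_eq_iff mat_def)

lemma matrix_mult_of_columns: "A ** of_columns f = of_columns (\<lambda>j. A *v f j)"
  by (simp add: of_columns_def matrix_matrix_mult_def matrix_vector_mult_def vec_eq_iff)

lemma smooth_on_of_columns:
  assumes "open S" "\<And>j. smooth_on S (f j)"
  shows "smooth_on S (\<lambda>x. of_columns (\<lambda>j. f j x))"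
proof -
  have "of_columns (\<lambda>j. f j x) = (\<Sum>j\<in>UNIV. of_columns (\<lambda>k. if k = j then f j x else 0))" for x
    by (simp add: of_columns_def vec_eq_iff if_distrib[of "\<lambda>y. y $ _"] cong: if_cong)
  moreover have "smooth_on S (\<lambda>x. of_columns (\<lambda>k. if k = j then f j x else 0))" for j
    by (rule smooth_on_linear[OF _ assms(1,2)]) (auto simp: linear_iff of_columns_def vec_eq_iff)
  ultimately show ?thesis
    using smooth_on_sum[OF assms(1), of UNIV "\<lambda>j x. of_columns (\<lambda>k. if k = j then f j x else 0)"]
    by simp
qed

text \<open>
  The Gram-Schmidt process with a parameter, one vector at a time. It starts from vectors that are orthonormal
  at \<open>x0\<close>, hence does not change them there. In particular the vector \<open>u\<close> left after subtracting projections
  has norm \<open>1\<close> at \<open>x0\<close>, and is nonzero on a neighbourhood, where it can be normalized smoothly.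
\<close>

lemma local_orthonormalization:
  fixes v :: "'i \<Rightarrow> 'a::euclidean_space \<Rightarrow> 'b::euclidean_space"
  assumes "finite I" "open S" "x0 \<in> S"
    and smooth: "\<And>i. i \<in> I \<Longrightarrow> smooth_on S (v i)"
    and on: "\<And>i j. i \<in> I \<Longrightarrow> j \<in> I \<Longrightarrow> v i x0 \<bullet> v j x0 = (if i = j then 1 else 0)"
  obtains U w where "open U" "x0 \<in> U" "\<And>i. i \<in> I \<Longrightarrow> smooth_on U (w i)"
    "\<And>i. i \<in> I \<Longrightarrow> w i x0 = v i x0"
    "\<And>i j x. i \<in> I \<Longrightarrow> j \<in> I \<Longrightarrow> x \<in> U \<Longrightarrow> w i x \<bullet> w j x = (if i = j then 1 else 0)"
    "\<And>i x. i \<in> I \<Longrightarrow> x \<in> U \<Longrightarrow> w i x \<in> span {v j x |j. j \<in> I}"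
proof -
  have "\<exists>U w. open U \<and> x0 \<in> U \<and> U \<subseteq> S \<and> (\<forall>i\<in>I. smooth_on U (w i)) \<and> (\<forall>i\<in>I. w i x0 = v i x0) \<and>
     (\<forall>i\<in>I. \<forall>j\<in>I. \<forall>x\<in>U. w i x \<bullet> w j x = (if i = j then 1 else 0)) \<and>
     (\<forall>i\<in>I. \<forall>x\<in>U. w i x \<in> span {v j x |j. j \<in> I})"
    using assms(1) smooth on
  proof (induction I)
    case empty
    then show ?case using assms(2,3) by auto
  next
    case (insert a I)
    have "\<exists>U w. open U \<and> x0 \<in> U \<and> U \<subseteq> S \<and> (\<forall>i\<in>I. smooth_on U (w i)) \<and> (\<forall>i\<in>I. w i x0 = v i x0) \<and>
     (\<forall>i\<in>I. \<forall>j\<in>I. \<forall>x\<in>U. w i x \<bullet> w j x = (if i = j then 1 else 0)) \<and>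
     (\<forall>i\<in>I. \<forall>x\<in>U. w i x \<in> span {v j x |j. j \<in> I})"
      by (rule insert.IH) (use insert.prems in auto)
    then obtain U w where U: "open U" "x0 \<in> U" "U \<subseteq> S" and *: "\<forall>i\<in>I. smooth_on U (w i)"
      "\<forall>i\<in>I. w i x0 = v i x0"
      "\<forall>i\<in>I. \<forall>j\<in>I. \<forall>x\<in>U. w i x \<bullet> w j x = (if i = j then 1 else 0)"
      "\<forall>i\<in>I. \<forall>x\<in>U. w i x \<in> span {v j x |j. j \<in> I}"
      by blast
    note w = *(1)[rule_format] and w0 = *(2)[rule_format] and won = *(3)[rule_format]
      and wspan = *(4)[rule_format]
    define u where "u x = v a x - (\<Sum>j\<in>I. (v a x \<bullet> w j x) *\<^sub>R w j x)" for x
    have va: "smooth_on U (v a)" using insert.prems(1) U(3) smooth_on_subset by blast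
    have u: "smooth_on U u" unfolding u_def
      by (intro smooth_on_diff smooth_on_sum smooth_on_bilinear[OF bounded_bilinear_scaleR]
          smooth_on_bilinear[OF bounded_bilinear_inner] U va w)
    have u0: "u x0 = v a x0"
      unfolding u_def using insert.prems(2)[of a] insert.hyps(2) by (auto simp: w0 intro!: sum.neutral)
    have uperp: "u x \<bullet> w i x = 0" if "i \<in> I" "x \<in> U" for i x
    proof -
      have "(\<Sum>j\<in>I. (v a x \<bullet> w j x) *\<^sub>R w j x) \<bullet> w i x = (\<Sum>j\<in>I. if j = i then v a x \<bullet> w i x else 0)"
        unfolding inner_sum_left using won that by (intro sum.cong) auto
      then show ?thesis using that insert.hyps(1) by (simp add: u_def inner_diff_left)
    qed
    have uspan: "u x \<in> span {v j x |j. j \<in> insert a I}" if "x \<in> U" for x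
    proof -
      have "w j x \<in> span {v j x |j. j \<in> insert a I}" if "j \<in> I" for j
        using wspan[OF that \<open>x \<in> U\<close>] span_mono[of "{v j x |j. j \<in> I}" "{v j x |j. j \<in> insert a I}"] by blast
      moreover have "v a x \<in> span {v j x |j. j \<in> insert a I}" by (rule span_base) auto
      ultimately show ?thesis unfolding u_def
        by (intro span_diff span_sum span_scale)
    qed
    define U' where "U' = U \<inter> u -` (- {0})"
    have U': "open U'" unfolding U'_def
      by (rule continuous_open_preimage[OF smooth_on_continuous_on[OF u] U(1)]) auto
    have nu0: "norm (u x0) = 1" using insert.prems(2)[of a a] by (simp add: u0 norm_eq_1)
    then have "x0 \<in> U'" using U by (auto simp: U'_def)
    define w' where "w' i = (if i = a then (\<lambda>x. u x /\<^sub>R norm (u x)) else w i)" for i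
    have na: "i \<noteq> a" if "i \<in> I" for i using that insert.hyps(2) by blast
    have "smooth_on U' (w' a)" unfolding w'_def
      using smooth_on_normalize[OF U' smooth_on_subset[OF u]] by (auto simp: U'_def)
    moreover have "smooth_on U' (w' i)" if "i \<in> I" for i
      using smooth_on_subset[OF w[OF that], of U'] na[OF that] by (simp add: w'_def U'_def)
    moreover have "w' i x0 = v i x0" if "i \<in> insert a I" for i
      using that w0 nu0 u0 by (auto simp: w'_def)
    moreover have "w' i x \<bullet> w' j x = (if i = j then 1 else 0)" if "i \<in> insert a I" "j \<in> insert a I" "x \<in> U'" for i j x
    proof -
      have "norm (u x) \<noteq> 0" "x \<in> U" using that(3) by (auto simp: U'_def)
      moreover from this have "(u x /\<^sub>R norm (u x)) \<bullet> (u x /\<^sub>R norm (u x)) = 1"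
        by (simp add: dot_square_norm power2_eq_square)
      ultimately show ?thesis
        using that won[of i j x] uperp[of i x] uperp[of j x] na by (auto simp: w'_def inner_commute)
    qed
    moreover have "w' i x \<in> span {v j x |j. j \<in> insert a I}" if "i \<in> insert a I" "x \<in> U'" for i x
    proof (cases "i = a")
      case True
      then show ?thesis using uspan[of x] that by (auto simp: w'_def U'_def intro: span_scale)
    next
      case False
      then have "w' i x \<in> span {v j x |j. j \<in> I}" using that wspan by (auto simp: w'_def U'_def)
      then show ?thesis using span_mono[of "{v j x |j. j \<in> I}" "{v j x |j. j \<in> insert a I}"] by blast
    qed
    moreover have "U' \<subseteq> S" using U(3) by (auto simp: U'_def)
    ultimately have "open U' \<and> x0 \<in> U' \<and> U' \<subseteq> S \<and> (\<forall>i\<in>insert a I. smooth_on U' (w' i)) \<and>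
      (\<forall>i\<in>insert a I. w' i x0 = v i x0) \<and>
      (\<forall>i\<in>insert a I. \<forall>j\<in>insert a I. \<forall>x\<in>U'. w' i x \<bullet> w' j x = (if i = j then 1 else 0)) \<and>
      (\<forall>i\<in>insert a I. \<forall>x\<in>U'. w' i x \<in> span {v j x |j. j \<in> insert a I})"
      using U' \<open>x0 \<in> U'\<close> by (intro conjI ballI) blast+
    then show ?case by blast
  qed
  then obtain U w where U: "open U" "x0 \<in> U" "\<forall>i\<in>I. smooth_on U (w i)" "\<forall>i\<in>I. w i x0 = v i x0"
    "\<forall>i\<in>I. \<forall>j\<in>I. \<forall>x\<in>U. w i x \<bullet> w j x = (if i = j then 1 else 0)"
    "\<forall>i\<in>I. \<forall>x\<in>U. w i x \<in> span {v j x |j. j \<in> I}"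
    by blast
  show thesis
    by (rule that[OF U(1,2) U(3)[rule_format] U(4)[rule_format] U(5)[rule_format] U(6)[rule_format]])
qed

lemma Grassmann_projection:
  fixes G :: "real^'n^'n"
  assumes "k \<le> CARD('n)" "G \<in> Grassmann (CARD('n) - k)"
  shows "transpose (mat 1 - G) = mat 1 - G" "(mat 1 - G) ** (mat 1 - G) = mat 1 - G" "rank (mat 1 - G) = k"
  using assms rank_complementary_projection[of G]
  by (auto simp: Grassmann_def transpose_simps(1-5) matrix_mult_distribs)

text \<open>
  A smooth local right inverse of \<open>V \<mapsto> I - VV\<^sup>T\<close> through a given \<open>V0\<close>: orthonormalize the columns of
  \<open>(I - G) V0\<close>. They lie in the range of \<open>I - G\<close>, and so do all their linear combinations.
  The section is defined, with orthonormal columns, for all matrices \<open>G\<close> near the given one and not only for those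
  in the Grassmannian, since smoothness on a subset refers to extensions to open sets.
\<close>

lemma Stiefel_section_ex:
  fixes V0 :: "real^'r^'n"
  assumes card: "CARD('r) \<le> CARD('n)" and V0: "V0 \<in> Stiefel"
  obtains U s where "open U" "mat 1 - V0 ** transpose V0 \<in> U" "smooth_on U s"
    "s (mat 1 - V0 ** transpose V0) = V0" "\<And>G. G \<in> U \<Longrightarrow> s G \<in> Stiefel"
    "\<And>G. G \<in> U \<Longrightarrow> G \<in> Grassmann (CARD('n) - CARD('r)) \<Longrightarrow> G = mat 1 - s G ** transpose (s G)"
proof -
  let ?G0 = "mat 1 - V0 ** transpose V0"
  define v where "v j G = (mat 1 - G) *v column j V0" for j and G :: "real^'n^'n"
  have v0: "v j ?G0 = column j V0" for j
  proof -
    have "of_columns (\<lambda>j. v j ?G0) = (V0 ** transpose V0) ** of_columns (\<lambda>j. column j V0)"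
      by (simp add: matrix_mult_of_columns v_def)
    also have "\<dots> = V0" by (simp add: of_columns_column Stiefel_cancel[OF V0])
    finally show ?thesis by (metis column_of_columns)
  qed
  have "smooth_on UNIV (v j)" for j
  proof -
    have "smooth_on UNIV (\<lambda>G. column j V0 - G *v column j V0)"
      by (intro smooth_on_diff smooth_on_const linear_imp_smooth_on)
         (auto simp: linear_iff matrix_vector_mult_add_rdistrib scaleR_matrix_vector_assoc)
    moreover have "v j = (\<lambda>G. column j V0 - G *v column j V0)"
      by (simp add: fun_eq_iff v_def matrix_vector_mult_diff_rdistrib)
    ultimately show ?thesis by simp
  qed
  note sm = this
  have on: "v i ?G0 \<bullet> v j ?G0 = (if i = j then 1 else 0)" for i j
    using V0 of_columns_Stiefel[of "\<lambda>j. column j V0"] by (simp add: v0 of_columns_column)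
  show thesis
  proof (rule local_orthonormalization[where I = UNIV, OF finite open_UNIV UNIV_I sm on])
    fix U w assume *: "open U" "?G0 \<in> U" "\<And>i. i \<in> UNIV \<Longrightarrow> smooth_on U (w i)"
      "\<And>i. i \<in> UNIV \<Longrightarrow> w i ?G0 = v i ?G0"
      "\<And>i j x. i \<in> UNIV \<Longrightarrow> j \<in> UNIV \<Longrightarrow> x \<in> U \<Longrightarrow> w i x \<bullet> w j x = (if i = j then 1 else 0)"
      "\<And>i x. i \<in> UNIV \<Longrightarrow> x \<in> U \<Longrightarrow> w i x \<in> span {v j x |j. j \<in> UNIV}"
    note U = *(1,2) *(3-6)[OF UNIV_I] and on_w = *(5)[OF UNIV_I UNIV_I]
    let ?s = "\<lambda>G. of_columns (\<lambda>j. w j G)"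
    show thesis
    proof (rule that[OF U(1,2), of ?s])
      show "smooth_on U ?s" using U by (intro smooth_on_of_columns)
      show "?s ?G0 = V0" by (simp add: U(4) v0 of_columns_column)
      show St: "?s G \<in> Stiefel" if "G \<in> U" for G using on_w[OF that] by (simp add: of_columns_Stiefel)
      fix G assume G: "G \<in> U" "G \<in> Grassmann (CARD('n) - CARD('r))"
      note P = Grassmann_projection[OF card G(2)]
      have "(mat 1 - G) *v y = y" if "y \<in> span {v j G |j. j \<in> UNIV}" for y
        using that
      proof (induction rule: span_induct)
        case base
        then show ?case by (auto simp: subspace_def matrix_vector_right_distrib scaleR_vector_matrix_assoc matrix_vector_mult_scaleR)
      next
        case (step y)
        then show ?case by (auto simp: v_def matrix_vector_mul_assoc P)
      qed
      then have "(mat 1 - G) ** ?s G = ?s G"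
        using U(6)[OF G(1)] by (simp add: matrix_mult_of_columns)
      from projection_eq_Stiefel[OF P(1,3) St[OF G(1)] this]
      show "G = mat 1 - ?s G ** transpose (?s G)" by (metis diff_diff_eq2 add_diff_cancel_left')
    qed
  qed
qed

lemma Grassmann_Stiefel_ex:
  fixes G :: "real^'n^'n"
  assumes card: "CARD('r::finite) \<le> CARD('n)" and G: "G \<in> Grassmann (CARD('n) - CARD('r))"
  obtains V :: "real^'r^'n" where "V \<in> Stiefel" "G = mat 1 - V ** transpose V"
proof -
  let ?P = "mat 1 - G"
  note P = Grassmann_projection[OF card G]
  have "subspace (range (\<lambda>x. ?P *v x))" by (auto intro: linear_subspace_image)
  then obtain B where B: "B \<subseteq> range (\<lambda>x. ?P *v x)" "pairwise orthogonal B" "\<And>x. x \<in> B \<Longrightarrow> norm x = 1"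
    "independent B" "card B = dim (range (\<lambda>x. ?P *v x))"
    using orthonormal_basis_subspace by metis
  then have "card B = CARD('r)" "finite B" using P(3) independent_imp_finite by (auto simp: rank_dim_range)
  then obtain f :: "'r \<Rightarrow> real^'n" where f: "bij_betw f UNIV B"
    using finite_same_card_bij[of "UNIV :: 'r set" B] by auto
  have V: "of_columns f \<in> Stiefel"
    unfolding of_columns_Stiefel
  proof (intro allI)
    fix i j
    show "f i \<bullet> f j = (if i = j then 1 else 0)"
    proof (cases "i = j")
      case True
      then show ?thesis using B(3)[of "f i"] bij_betwE[OF f] by (auto simp: norm_eq_1)
    next
      case False
      then have "f i \<noteq> f j" "f i \<in> B" "f j \<in> B" using f by (auto simp: bij_betw_def inj_eq)
      then show ?thesis using B(2) False by (auto simp: pairwise_def orthogonal_def)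
    qed
  qed
  have "?P *v f j = f j" for j
  proof -
    have "f j \<in> B" using f by (auto simp: bij_betw_def)
    then obtain x where "f j = ?P *v x" using B(1) by blast
    then show ?thesis by (metis P(2) matrix_vector_mul_assoc)
  qed
  then have "?P ** of_columns f = of_columns f" by (simp add: matrix_mult_of_columns)
  from projection_eq_Stiefel[OF P(1,3) V this] have "G = mat 1 - of_columns f ** transpose (of_columns f)"
    by (metis diff_diff_eq2 add_diff_cancel_left')
  with V that show thesis by blast
qed

text \<open>
  The map sending each column of \<open>E\<close> to that of \<open>V\<close> is isometric on the range of \<open>E\<close>. The orthogonal
  complements of the two ranges have equal dimension, so there is also an isometry \<open>f\<close> between them, and the sum
  \<open>q\<close> of the two is the orthogonal map sought.
\<close>

lemma Stiefel_transitive: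
  fixes V E :: "real^'r^'n"
  assumes V: "V \<in> Stiefel" and E: "E \<in> Stiefel"
  obtains Q where "orthogonal_matrix Q" "V = Q ** E"
proof -
  let ?PV = "mat 1 - V ** transpose V" and ?PE = "mat 1 - E ** transpose E"
  let ?S = "range (\<lambda>x. ?PE *v x)" and ?T = "range (\<lambda>x. ?PV *v x)"
  have "subspace ?S" "subspace ?T" by (auto intro: linear_subspace_image)
  moreover have "dim ?S = dim ?T"
    using Stiefel_Grassmann[OF V] Stiefel_Grassmann[OF E] by (simp add: Grassmann_def rank_dim_range)
  ultimately obtain f where f: "linear f" "f ` ?S = ?T" "\<And>x. x \<in> ?S \<Longrightarrow> norm (f x) = norm x"
    using isometries_subspaces by metis
  define q where "q x = V *v (transpose E *v x) + f (?PE *v x)" for x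
  have norm2: "norm (A *v y + z) ^ 2 = norm y ^ 2 + norm z ^ 2"
    if "A \<in> Stiefel" "transpose A *v z = 0" for A :: "real^'r^'n" and y z
  proof -
    have "(A *v y) \<bullet> (A *v y) = y \<bullet> y" "(A *v y) \<bullet> z = 0"
    proof -
      have d: "(A *v y) \<bullet> u = y \<bullet> (transpose A *v u)" for u
        by (metis dot_lmul_matrix transpose_matrix_vector inner_commute)
      show "(A *v y) \<bullet> (A *v y) = y \<bullet> y"
        using that(1) by (simp only: d matrix_vector_mul_assoc) (simp add: Stiefel_iff)
      show "(A *v y) \<bullet> z = 0" using that(2) d by simp
    qed
    then show ?thesis
      unfolding power2_norm_eq_inner by (simp add: inner_add_left inner_add_right inner_commute)
  qed
  have perp: "transpose A *v ((mat 1 - A ** transpose A) *v x) = 0" if "A \<in> Stiefel" for A :: "real^'r^'n" and x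
    using that by (simp only: matrix_vector_mul_assoc) (simp add: matrix_mult_distribs Stiefel_cancel)
  have "norm (q x) = norm x" for x
  proof -
    have "f (?PE *v x) \<in> ?T" using f(2) by blast
    then have "transpose V *v f (?PE *v x) = 0" using perp[OF V] by force
    then have "norm (q x) ^ 2 = norm (transpose E *v x) ^ 2 + norm (?PE *v x) ^ 2"
      unfolding q_def using norm2[OF V] f(3) by simp
    also have "\<dots> = norm (E *v (transpose E *v x) + ?PE *v x) ^ 2"
      using norm2[OF E perp[OF E]] by simp
    also have "E *v (transpose E *v x) + ?PE *v x = x"
      by (simp add: matrix_vector_mult_diff_rdistrib matrix_vector_mul_assoc del: transpose_matrix_vector)
    finally show ?thesis by simp
  qed
  moreover have lin: "linear q"
    unfolding q_def
    by (intro linear_compose_add linear_compose[OF _ f(1), unfolded o_def]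
        linear_compose[OF _ matrix_vector_mul_linear, unfolded o_def] matrix_vector_mul_linear)
  ultimately have "orthogonal_matrix (matrix q)"
    using orthogonal_transformation orthogonal_transformation_matrix by blast
  moreover have "V = matrix q ** E"
  proof (subst matrix_eq, intro allI)
    fix x
    have "(matrix q ** E) *v x = q (E *v x)"
      using lin by (simp add: matrix_vector_mul_assoc[symmetric] matrix_works linear_matrix_vector_mul_eq)
    also have "\<dots> = V *v x"
    proof -
      have "?PE *v (E *v x) = 0" 
        using E by (simp add: matrix_vector_mul_assoc matrix_mult_distribs matrix_mul_assoc Stiefel_cancel)
      moreover have "transpose E *v (E *v x) = x"
        using E by (simp only: matrix_vector_mul_assoc) (simp add: Stiefel_iff)
      ultimately show ?thesis using linear_0[OF f(1)] by (simp add: q_def)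
    qed
    finally show "V *v x = (matrix q ** E) *v x" by simp
  qed
  ultimately show thesis using that by blast
qed

section \<open>Representations of points and tangent vectors\<close>

lemma has_vector_derivative_matrix_mult:
  fixes f :: "real \<Rightarrow> real^'n^'m" and g :: "real \<Rightarrow> real^'p^'n"
  assumes "(f has_vector_derivative f') (at x)" "(g has_vector_derivative g') (at x)"
  shows "((\<lambda>t. f t ** g t) has_vector_derivative (f x ** g' + f' ** g x)) (at x)"
  by (rule bounded_bilinear.has_vector_derivative[OF bounded_bilinear_matrix_mult assms])

lemma has_vector_derivative_transpose:
  fixes f :: "real \<Rightarrow> real^'n^'m"
  assumes "(f has_vector_derivative f') (at x)"
  shows "((\<lambda>t. transpose (f t)) has_vector_derivative transpose f') (at x)"
  using bounded_linear.has_vector_derivative[OF _ assms] linear_transpose linear_conv_bounded_linear by blast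

lemma smooth_on_has_vector_derivative:
  "smooth_on S c \<Longrightarrow> t \<in> S \<Longrightarrow> (c has_vector_derivative vector_derivative c (at t)) (at t)"
  using smooth_on_differentiable vector_derivative_works by blast

lemma Stiefel_orthogonal_mult_right:
  assumes "V \<in> Stiefel" "orthogonal_matrix Q" shows "V ** Q \<in> Stiefel"
proof -
  have "transpose Q ** (transpose V ** V) ** Q = mat 1"
    using assms by (simp add: Stiefel_iff orthogonal_matrix)
  then show ?thesis by (simp add: Stiefel_iff matrix_transpose_mul matrix_mul_assoc)
qed

lemma Stiefel_orthogonal_mult_left:
  assumes "V \<in> Stiefel" "orthogonal_matrix Q" shows "Q ** V \<in> Stiefel"
proof -
  have "transpose V ** (transpose Q ** Q) ** V = mat 1"
    using assms by (simp add: Stiefel_iff orthogonal_matrix)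
  then show ?thesis by (simp add: Stiefel_iff matrix_transpose_mul matrix_mul_assoc)
qed

text \<open>
  Rotate \<open>V\<close> by orthogonal matrices with the skew-symmetric velocity \<open>A = W V\<^sup>T - V W\<^sup>T\<close>: since \<open>V\<^sup>T W = 0\<close>,
  \<open>A V = W\<close>.
\<close>

lemma Stiefel_tangentI:
  fixes V W :: "real^'r^'n"
  assumes V: "V \<in> Stiefel" and VW: "transpose V ** W = 0"
  shows "W \<in> tangent_space Stiefel V"
proof -
  let ?A = "W ** transpose V - V ** transpose W"
  have "transpose ?A = - ?A" by (simp add: transpose_simps)
  then obtain Q where Q: "smooth_on UNIV Q" "\<And>t. orthogonal_matrix (Q t)"
    "Q 0 = mat 1" "(Q has_vector_derivative ?A) (at 0)"
    using orthogonal_curve_ex by metis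
  have WV: "transpose W ** V = 0" using arg_cong[OF VW, of transpose] by (simp add: transpose_simps)
  have "((\<lambda>t. Q t ** V) has_vector_derivative (Q 0 ** 0 + ?A ** V)) (at 0)"
    by (rule has_vector_derivative_matrix_mult[OF Q(4)]) simp
  moreover have "?A ** V = W"
    by (simp add: matrix_mult_distribs Stiefel_cancel(1)[OF V]) (simp add: matrix_mul_assoc[symmetric] WV)
  ultimately show ?thesis
    using Q V by (intro tangent_spaceI[of UNIV "\<lambda>t. Q t ** V"])
       (auto intro: smooth_on_bilinear[OF bounded_bilinear_matrix_mult] smooth_on_const Stiefel_orthogonal_mult_left)
qed

locale invariant_zero_set =
  fixes h :: "real^'n^'m \<Rightarrow> real^'q" and \<iota> :: "'r::finite \<Rightarrow> 'n"
  assumes inj: "inj \<iota>" and inv: "orthogonally_invariant h"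
begin

abbreviation "\<H> \<equiv> Hr h \<iota>"

lemma card_le: "CARD('r) \<le> CARD('n)"
  using inj card_inj_on_le[of \<iota> UNIV UNIV] by simp

text \<open>
  Padding is multiplication by the transpose of a particular frame, whose columns are the standard basis
  vectors \<open>e\<^bsub>\<iota>(j)\<^esub>\<close>.
\<close>

lemma pad_columns_eq:
  obtains E :: "real^'r^'n" where "E \<in> Stiefel" "\<And>H :: real^'r^'m. pad_columns \<iota> H = H ** transpose E"
proof
  let ?E = "of_columns (\<lambda>j. axis (\<iota> j) 1) :: real^'r^'n"
  show "?E \<in> Stiefel" using inj by (simp add: of_columns_Stiefel inner_axis_axis inj_eq)
  fix H :: "real^'r^'m"
  have "(\<Sum>j\<in>UNIV. H $ i $ j * (if k = \<iota> j then 1 else 0)) = (if k \<in> range \<iota> then H $ i $ inv \<iota> k else 0)" for i k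
  proof (cases "k \<in> range \<iota>")
    case True
    then obtain j0 where "k = \<iota> j0" by blast
    then show ?thesis using inj by (simp add: inj_eq if_distrib cong: if_cong)
  next
    case False
    then have "k \<noteq> \<iota> j" for j by blast
    then show ?thesis using False by simp
  qed
  then show "pad_columns \<iota> H = H ** transpose ?E"
    by (simp add: pad_columns_def vec_eq_iff matrix_matrix_mult_def transpose_def of_columns_def axis_def)
qed

text \<open>
  Orthogonal invariance of \<open>h\<close> allows the frame of standard basis vectors in the definition of \<open>Hr\<close> to be
  replaced by any other frame.
\<close>

lemma Hr_iff:
  assumes V: "V \<in> Stiefel"
  shows "H \<in> \<H> \<longleftrightarrow> h (H ** transpose V) = 0"
proof -
  obtain E :: "real^'r^'n" where E: "E \<in> Stiefel" "\<And>H :: real^'r^'m. pad_columns \<iota> H = H ** transpose E"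
    by (rule pad_columns_eq) blast
  obtain Q where Q: "orthogonal_matrix Q" "V = Q ** E" using Stiefel_transitive[OF V E(1)] by metis
  then have "h (H ** transpose V) = h ((H ** transpose E) ** transpose Q)"
    by (simp add: matrix_transpose_mul matrix_mul_assoc)
  also have "\<dots> = h (H ** transpose E)"
    using inv Q(1) unfolding orthogonally_invariant_def by (metis orthogonal_matrix_transpose)
  finally show ?thesis by (simp add: Hr_def E(2))
qed

lemma Stiefel_nonempty: obtains V :: "real^'r^'n" where "V \<in> Stiefel"
  by (rule pad_columns_eq) blast

lemma Hr_orthogonal_mult:
  assumes "H \<in> \<H>" "orthogonal_matrix Q" shows "H ** Q \<in> \<H>"
proof -
  obtain V :: "real^'r^'n" where V: "V \<in> Stiefel" by (rule Stiefel_nonempty)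
  have "V ** transpose Q \<in> Stiefel" using V assms(2) by (simp add: Stiefel_orthogonal_mult_right)
  then show ?thesis
    using assms(1) Hr_iff[OF V, of "H ** Q"] Hr_iff[of "V ** transpose Q" H]
    by (simp add: matrix_transpose_mul matrix_mul_assoc)
qed

lemma represents_simp [simp]:
  "represents h \<iota> (H, V) (X, G) \<longleftrightarrow>
     H \<in> \<H> \<and> V \<in> Stiefel \<and> X = H ** transpose V \<and> G = mat 1 - V ** transpose V"
  by (simp add: represents_def)

lemma represents_tangent_simp [simp]:
  "represents_tangent h \<iota> (H, V) (K, W) (\<eta>, \<zeta>) \<longleftrightarrow>
     K \<in> tangent_space \<H> H \<and> transpose V ** W = 0 \<and>
     \<eta> = K ** transpose V + H ** transpose W \<and>
     \<zeta> = - (W ** transpose V) - V ** transpose W"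
  by (simp add: represents_tangent_def)

lemma represents_imp_Mh:
  assumes "represents h \<iota> (H, V) p" shows "p \<in> Mh CARD('r) h"
proof -
  obtain X G where p: "p = (X, G)" by (cases p)
  then have *: "H \<in> \<H>" "V \<in> Stiefel" "X = H ** transpose V" "G = mat 1 - V ** transpose V"
    using assms by auto
  then show ?thesis
    using Stiefel_Grassmann[OF *(2)] Hr_iff[OF *(2)]
    by (simp add: p Mh_def matrix_mult_distribs matrix_mul_assoc Stiefel_cancel[OF *(2)])
qed

lemma represents_section:
  assumes "(X, G) \<in> Mh CARD('r) h" "V \<in> Stiefel" "G = mat 1 - V ** transpose V"
  shows "represents h \<iota> (X ** V, V) (X, G)"
proof -
  have "X ** G = 0" "h X = 0" using assms(1) by (auto simp: Mh_def)
  then have "X = X ** V ** transpose V" using assms(3) by (simp add: matrix_mult_distribs matrix_mul_assoc)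
  then show ?thesis using assms \<open>h X = 0\<close> Hr_iff[OF assms(2), of "X ** V"] by simp
qed

lemma represents_ex:
  assumes "p \<in> Mh CARD('r) h" obtains H V where "represents h \<iota> (H, V) p"
proof -
  obtain X G where p: "p = (X, G)" by (cases p)
  then have "G \<in> Grassmann (CARD('n) - CARD('r))" using assms by (simp add: Mh_def)
  then obtain V :: "real^'r^'n" where "V \<in> Stiefel" "G = mat 1 - V ** transpose V"
    using Grassmann_Stiefel_ex[OF card_le] by metis
  then show thesis using represents_section assms p that by blast
qed

text \<open>
  Two frames of the same subspace differ by the orthogonal matrix \<open>Q = V\<^sup>T V2\<close>.
\<close>

lemma represents_unique:
  assumes 1: "represents h \<iota> (H, V) p" and 2: "represents h \<iota> (H2, V2) p"
  obtains Q where "orthogonal_matrix Q" "H2 = H ** Q" "V2 = V ** Q"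
proof -
  have V: "V \<in> Stiefel" "V2 \<in> Stiefel" and X: "H ** transpose V = H2 ** transpose V2"
    and G: "V ** transpose V = V2 ** transpose V2"
    using 1 2 by (cases p; auto)+
  let ?Q = "transpose V ** V2"
  have "V ** ?Q = V2" by (simp add: matrix_mul_assoc G Stiefel_cancel[OF V(2)])
  moreover have "H ** ?Q = H2" by (simp add: matrix_mul_assoc X Stiefel_cancel[OF V(2)])
  moreover have "transpose ?Q ** ?Q = mat 1"
  proof -
    have "transpose ?Q ** ?Q = transpose V2 ** (V ** ?Q)" by (simp add: matrix_transpose_mul matrix_mul_assoc)
    then show ?thesis using V(2) by (simp add: \<open>V ** ?Q = V2\<close> Stiefel_iff)
  qed
  ultimately show thesis using that[of ?Q] by (simp add: orthogonal_matrix)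
qed

text \<open>
  The set \<open>Hr\<close> is stable under orthogonal right factors, so a curve \<open>c\<close> in it may be replaced by \<open>c Q\<close>, where
  \<open>Q\<close> is a curve of orthogonal matrices with velocity \<open>\<Omega>\<close>.
\<close>

lemma Hr_tangent_add_skew:
  assumes K: "K \<in> tangent_space \<H> H" and skew: "transpose \<Omega> = - \<Omega>"
  shows "K + H ** \<Omega> \<in> tangent_space \<H> H"
proof -
  obtain c S where c: "open S" "0 \<in> S" "smooth_on S c" "\<And>t. t \<in> S \<Longrightarrow> c t \<in> \<H>" "c 0 = H"
    "(c has_vector_derivative K) (at 0)"
    using tangent_spaceE[OF K] by metis
  obtain Q where Q: "smooth_on UNIV Q" "\<And>t. orthogonal_matrix (Q t)"
    "Q 0 = mat 1" "(Q has_vector_derivative \<Omega>) (at 0)"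
    using orthogonal_curve_ex[OF skew] by metis
  have "((\<lambda>t. c t ** Q t) has_vector_derivative (c 0 ** \<Omega> + K ** Q 0)) (at 0)"
    by (rule has_vector_derivative_matrix_mult[OF c(6) Q(4)])
  then have "((\<lambda>t. c t ** Q t) has_vector_derivative (K + H ** \<Omega>)) (at 0)"
    by (simp add: c(5) Q(3) add.commute)
  then show ?thesis
    using c Q smooth_on_subset[OF Q(1)]
    by (intro tangent_spaceI[of S "\<lambda>t. c t ** Q t"])
       (auto intro: smooth_on_bilinear[OF bounded_bilinear_matrix_mult] Hr_orthogonal_mult)
qed

text \<open>
  Curves in the two factors with the given velocities combine to a curve in \<open>Mh\<close>.
\<close>

lemma represents_tangent_imp_tangent:
  assumes p: "represents h \<iota> (H, V) p" and \<xi>: "represents_tangent h \<iota> (H, V) (K, W) \<xi>"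
  shows "\<xi> \<in> tangent_space (Mh CARD('r) h) p"
proof -
  obtain \<eta> \<zeta> where [simp]: "\<xi> = (\<eta>, \<zeta>)" by (cases \<xi>)
  obtain X G where [simp]: "p = (X, G)" by (cases p)
  have V: "V \<in> Stiefel" and K: "K \<in> tangent_space \<H> H" and VW: "transpose V ** W = 0"
    using p \<xi> by auto
  obtain a S where a: "open S" "0 \<in> S" "smooth_on S a" "\<And>t. t \<in> S \<Longrightarrow> a t \<in> \<H>" "a 0 = H"
    "(a has_vector_derivative K) (at 0)"
    using tangent_spaceE[OF K] by metis
  obtain b T where b: "open T" "0 \<in> T" "smooth_on T b" "\<And>t. t \<in> T \<Longrightarrow> b t \<in> Stiefel" "b 0 = V"
    "(b has_vector_derivative W) (at 0)"
    using tangent_spaceE[OF Stiefel_tangentI[OF V VW]] by metis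
  let ?c = "\<lambda>t. (a t ** transpose (b t), mat 1 - b t ** transpose (b t))"
  have o: "open (S \<inter> T)" using a b by auto
  note sa = smooth_on_subset[OF a(3), of "S \<inter> T", OF Int_lower1]
  note sb = smooth_on_subset[OF b(3), of "S \<inter> T", OF Int_lower2]
  show ?thesis
  proof (rule tangent_spaceI[of "S \<inter> T" ?c, OF o])
    show "smooth_on (S \<inter> T) ?c"
      by (intro smooth_on_Pair smooth_on_diff smooth_on_const o
          smooth_on_bilinear[OF bounded_bilinear_matrix_mult] sa sb smooth_on_linear[OF linear_transpose])
    show "?c t \<in> Mh CARD('r) h" if "t \<in> S \<inter> T" for t
      using that a(4) b(4) by (intro represents_imp_Mh[of "a t" "b t"]) auto
    show "?c 0 = p" using p by (simp add: a(5) b(5))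
    note bT = has_vector_derivative_transpose[OF b(6)]
    have "(?c has_vector_derivative (a 0 ** transpose W + K ** transpose (b 0),
        0 - (b 0 ** transpose W + W ** transpose (b 0)))) (at 0)"
      by (intro has_vector_derivative_Pair has_vector_derivative_diff has_vector_derivative_const
          has_vector_derivative_matrix_mult a(6) b(6) bT)
    moreover have "(a 0 ** transpose W + K ** transpose (b 0),
        0 - (b 0 ** transpose W + W ** transpose (b 0))) = \<xi>"
      using \<xi> by (simp add: a(5) b(5))
    ultimately show "(?c has_vector_derivative \<xi>) (at 0)" by simp
  qed (use a b in auto)
qed

text \<open>
  Multiply the formulas for \<open>\<eta>\<close> and \<open>\<zeta>\<close> by \<open>V\<close> and use \<open>V\<^sup>T V = I\<close> and \<open>W\<^sup>T V = 0\<close>. These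
  expressions are the reason why uniqueness, linearity and smooth dependence of representatives come for free.
\<close>

lemma represents_tangent_determined:
  assumes "V \<in> Stiefel" "represents_tangent h \<iota> (H, V) (K, W) \<xi>"
  shows "K = fst \<xi> ** V" "W = - (snd \<xi> ** V)"
proof -
  obtain \<eta> \<zeta> where \<xi>: "\<xi> = (\<eta>, \<zeta>)" by (cases \<xi>)
  have *: "transpose V ** W = 0" "\<eta> = K ** transpose V + H ** transpose W"
     "\<zeta> = - (W ** transpose V) - V ** transpose W" using assms(2) by (auto simp: \<xi>)
  have "transpose W ** V = 0" using arg_cong[OF *(1), of transpose] by (simp add: transpose_simps)
  then have "A ** transpose W ** V = 0" for A :: "real^'r^'x" by (simp add: matrix_mul_assoc[symmetric])
  then show "K = fst \<xi> ** V" "W = - (snd \<xi> ** V)"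
    by (simp_all add: \<xi> *(2,3) matrix_mult_distribs Stiefel_cancel[OF assms(1)])
qed

text \<open>
  Every velocity of a curve \<open>c\<close> in \<open>Mh\<close> has the form required of a represented tangent vector. With a smooth
  frame \<open>v(t)\<close> of the range of \<open>I - G(t)\<close>, starting at \<open>V\<close>, the curve \<open>c\<close> is represented by \<open>v\<close> and
  \<open>w(t) = X(t) v(t)\<close>. Differentiating at \<open>0\<close> gives velocities \<open>H'\<close> and \<open>V'\<close>, but in general \<open>V\<^sup>T V'\<close> is not
  zero; it is a skew-symmetric matrix \<open>\<Omega>\<close>. The pair \<open>(H' - H\<Omega>, V' - V\<Omega>)\<close> represents the same
  vector and satisfies the normalization.
\<close>

lemma tangent_imp_represents_tangent:
  assumes p: "represents h \<iota> (H, V) p" and \<xi>: "\<xi> \<in> tangent_space (Mh CARD('r) h) p"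
  shows "represents_tangent h \<iota> (H, V) (fst \<xi> ** V, - (snd \<xi> ** V)) \<xi>"
proof -
  obtain \<eta> \<zeta> where \<xi>_eq [simp]: "\<xi> = (\<eta>, \<zeta>)" by (cases \<xi>)
  obtain X G where p_eq [simp]: "p = (X, G)" by (cases p)
  have V: "V \<in> Stiefel" and X: "X = H ** transpose V" and G: "G = mat 1 - V ** transpose V"
    using p by auto
  obtain c S where c: "open S" "0 \<in> S" "smooth_on S c" "\<And>t. t \<in> S \<Longrightarrow> c t \<in> Mh CARD('r) h" "c 0 = (X, G)"
    "(c has_vector_derivative (\<eta>, \<zeta>)) (at 0)"
    using tangent_spaceE[OF \<xi>] by (metis \<xi>_eq p_eq)
  obtain U s where U: "open U" "G \<in> U" "smooth_on U s"
    "s G = V" "\<And>G. G \<in> U \<Longrightarrow> s G \<in> Stiefel"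
    "\<And>G. G \<in> U \<Longrightarrow> G \<in> Grassmann (CARD('n) - CARD('r)) \<Longrightarrow> G = mat 1 - s G ** transpose (s G)"
    using Stiefel_section_ex[OF card_le V, folded G] by metis
  have scX: "smooth_on S (\<lambda>t. fst (c t))" and scG: "smooth_on S (\<lambda>t. snd (c t))"
    by (auto intro: smooth_on_linear[OF linear_fst c(1,3)] smooth_on_linear[OF linear_snd c(1,3)])
  define S' where "S' = S \<inter> (\<lambda>t. snd (c t)) -` U"
  have S': "open S'" unfolding S'_def
    by (rule continuous_open_preimage[OF smooth_on_continuous_on[OF scG] c(1) U(1)])
  have sub: "S' \<subseteq> S" and 0: "0 \<in> S'" using c U by (auto simp: S'_def)
  define v where "v t = s (snd (c t))" for t
  have v0: "v 0 = V" by (simp add: v_def c(5) U(4))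
  have sv: "smooth_on S' v" unfolding v_def
    by (rule smooth_on_compose[OF S' smooth_on_subset[OF scG sub] U(3)]) (auto simp: S'_def)
  define w where "w t = fst (c t) ** v t" for t
  have sw: "smooth_on S' w" unfolding w_def
    by (intro smooth_on_bilinear[OF bounded_bilinear_matrix_mult] S' smooth_on_subset[OF scX sub] sv)
  have rep: "represents h \<iota> (w t, v t) (c t)" if "t \<in> S'" for t
  proof -
    have ct: "(fst (c t), snd (c t)) \<in> Mh CARD('r) h" "snd (c t) \<in> U" using c(4) that by (auto simp: S'_def)
    then have "snd (c t) \<in> Grassmann (CARD('n) - CARD('r))" by (simp add: Mh_def split_beta)
    with represents_section[OF ct(1) U(5)[OF ct(2)] U(6)[OF ct(2)]] show ?thesis
      by (simp add: v_def w_def)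
  qed
  have vS: "v t \<in> Stiefel" and cX: "fst (c t) = w t ** transpose (v t)"
    and cG: "snd (c t) = mat 1 - v t ** transpose (v t)" and wH: "w t \<in> \<H>" if "t \<in> S'" for t
    using rep[OF that] by (cases "c t"; simp)+
  have w0: "w 0 = H" by (simp add: w_def v0 c(5) X Stiefel_cancel[OF V])
  define V' where "V' = vector_derivative v (at 0)"
  define H' where "H' = vector_derivative w (at 0)"
  have dv: "(v has_vector_derivative V') (at 0)" unfolding V'_def
    using smooth_on_has_vector_derivative[OF sv 0] .
  have dw: "(w has_vector_derivative H') (at 0)" unfolding H'_def
    using smooth_on_has_vector_derivative[OF sw 0] .
  note dvT = has_vector_derivative_transpose[OF dv]
  \<comment> \<open>Differentiating \<open>v\<^sup>T v = I\<close> shows that \<open>V\<^sup>T V'\<close> is skew-symmetric.\<close>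
  have "((\<lambda>t. transpose (v t) ** v t) has_vector_derivative (transpose V ** V' + transpose V' ** V)) (at 0)"
    using has_vector_derivative_matrix_mult[OF dvT dv] by (simp add: v0)
  moreover have "((\<lambda>t. transpose (v t) ** v t) has_vector_derivative 0) (at 0)"
    by (rule has_vector_derivative_transform_within_open[OF has_vector_derivative_const S' 0, of "mat 1"])
       (use vS in \<open>simp add: Stiefel_iff\<close>)
  ultimately have skew0: "transpose V ** V' + transpose V' ** V = 0"
    by (rule vector_derivative_unique_at)
  \<comment> \<open>The velocity of \<open>c\<close> is computed a second time from the lifted curves and compared.\<close>
  have d\<eta>: "((\<lambda>t. fst (c t)) has_vector_derivative \<eta>) (at 0)"
    using bounded_linear.has_vector_derivative[OF bounded_linear_fst c(6)] by simp
  have d\<zeta>: "((\<lambda>t. snd (c t)) has_vector_derivative \<zeta>) (at 0)"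
    using bounded_linear.has_vector_derivative[OF bounded_linear_snd c(6)] by simp
  have "((\<lambda>t. fst (c t)) has_vector_derivative (w 0 ** transpose V' + H' ** transpose (v 0))) (at 0)"
    by (rule has_vector_derivative_transform_within_open[OF has_vector_derivative_matrix_mult[OF dw dvT] S' 0])
       (use cX in simp)
  then have \<eta>: "\<eta> = H ** transpose V' + H' ** transpose V"
    using vector_derivative_unique_at[OF d\<eta>] by (simp add: w0 v0)
  have "((\<lambda>t. snd (c t)) has_vector_derivative (0 - (v 0 ** transpose V' + V' ** transpose (v 0)))) (at 0)"
    by (rule has_vector_derivative_transform_within_open[OF has_vector_derivative_diff[OF
          has_vector_derivative_const has_vector_derivative_matrix_mult[OF dv dvT]] S' 0])
       (use cG in simp)
  then have \<zeta>: "\<zeta> = - (V ** transpose V') - V' ** transpose V"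
    using vector_derivative_unique_at[OF d\<zeta>] by (simp add: v0)
  define \<Omega> where "\<Omega> = transpose V ** V'"
  have \<Omega>T: "transpose \<Omega> = - \<Omega>"
    using skew0 by (simp add: \<Omega>_def transpose_simps(6) eq_neg_iff_add_eq_0 add.commute)
  have V'V: "transpose V' ** V = - \<Omega>" using \<Omega>T by (simp add: \<Omega>_def transpose_simps(6))
  then have V'V_assoc: "A ** transpose V' ** V = - (A ** \<Omega>)" for A :: "real^'r^'x"
    by (simp add: matrix_mul_assoc[symmetric] matrix_mult_distribs)
  have H': "H' \<in> tangent_space \<H> H"
    by (rule tangent_spaceI[OF S' 0 sw wH w0 dw])
  have K: "\<eta> ** V = H' + H ** (- \<Omega>)"
    by (simp add: \<eta> matrix_mult_distribs V'V_assoc Stiefel_cancel[OF V])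
  have W: "- (\<zeta> ** V) = V' - V ** \<Omega>"
    by (simp add: \<zeta> matrix_mult_distribs V'V_assoc Stiefel_cancel[OF V])
  have "H' + H ** (- \<Omega>) \<in> tangent_space \<H> H"
    by (rule Hr_tangent_add_skew[OF H']) (simp add: transpose_simps \<Omega>T)
  moreover have "transpose V ** (V' - V ** \<Omega>) = 0"
    by (simp add: matrix_mult_distribs Stiefel_cancel[OF V] \<Omega>_def)
  moreover have "\<eta> = (H' + H ** (- \<Omega>)) ** transpose V + H ** transpose (V' - V ** \<Omega>)"
    by (simp add: \<eta> matrix_mult_distribs transpose_simps \<Omega>T matrix_mul_assoc)
  moreover have "\<zeta> = - ((V' - V ** \<Omega>) ** transpose V) - V ** transpose (V' - V ** \<Omega>)"
    by (simp add: \<zeta> matrix_mult_distribs transpose_simps \<Omega>T matrix_mul_assoc)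
  ultimately have "represents_tangent h \<iota> (H, V) (H' + H ** (- \<Omega>), V' - V ** \<Omega>) (\<eta>, \<zeta>)"
    unfolding represents_tangent_simp by blast
  then show ?thesis by (simp only: \<xi>_eq fst_conv snd_conv K W)
qed

end

section \<open>Gluing retractions and vector transports\<close>

lemma smooth_map_on_retraction:
  fixes R :: "'x::euclidean_space \<Rightarrow> 'x \<Rightarrow> 'x"
  assumes "retraction_on M R" "smooth_map_on N f" "smooth_map_on N k"
    "\<And>z. z \<in> N \<Longrightarrow> (f z, k z) \<in> tangent_bundle M"
  shows "smooth_map_on N (\<lambda>z. R (f z) (k z))"
proof -
  have "smooth_map_on (tangent_bundle M) (\<lambda>(x, v). R x v)" using assms(1) by (simp add: retraction_on_def)
  from smooth_map_on_compose[OF smooth_map_on_Pair[OF assms(2,3)] this] show ?thesis using assms(4) by auto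
qed

lemma smooth_map_on_transport:
  fixes T :: "'x::euclidean_space \<Rightarrow> 'x \<Rightarrow> 'x \<Rightarrow> 'x"
  assumes "vector_transport_on M R T" "smooth_map_on N f" "smooth_map_on N u" "smooth_map_on N v"
    "\<And>z. z \<in> N \<Longrightarrow> (f z, u z, v z) \<in> tangent_bundle_sum M"
  shows "smooth_map_on N (\<lambda>z. T (f z) (u z) (v z))"
proof -
  have "smooth_map_on (tangent_bundle_sum M) (\<lambda>z. snd (case z of (x, u, v) \<Rightarrow> (R x u, T x u v)))"
    using assms(1) by (intro smooth_map_on_linear[OF linear_snd]) (simp add: vector_transport_on_def)
  from smooth_map_on_compose[OF smooth_map_on_Pair[OF assms(2) smooth_map_on_Pair[OF assms(3,4)]] this]
  show ?thesis using assms(5) by auto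
qed

definition glue :: "real^'r^'m \<Rightarrow> real^'r^'n \<Rightarrow> (real^'n^'m) \<times> (real^'n^'n)" where
  "glue H V = (H ** transpose V, mat 1 - V ** transpose V)"

definition glue_tangent ::
  "real^'r^'m \<Rightarrow> real^'r^'n \<Rightarrow> real^'r^'m \<Rightarrow> real^'r^'n \<Rightarrow> (real^'n^'m) \<times> (real^'n^'n)" where
  "glue_tangent H V K W = (K ** transpose V + H ** transpose W, - (W ** transpose V) - V ** transpose W)"

text \<open>
  The representatives \<open>K = \<eta>V\<close> and \<open>V\<^sub>p = - \<zeta>V\<close> of a tangent vector \<open>(\<eta>, \<zeta>)\<close>. They are given by
  formulas that make sense for all pairs of matrices, and so are linear without reference to a tangent space.
\<close>

definition lift_H :: "real^'r^'n \<Rightarrow> (real^'n^'m) \<times> (real^'n^'n) \<Rightarrow> real^'r^'m" where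
  "lift_H V \<xi> = fst \<xi> ** V"

definition lift_V :: "real^'r^'n \<Rightarrow> (real^'n^'m) \<times> (real^'n^'n) \<Rightarrow> real^'r^'n" where
  "lift_V V \<xi> = - (snd \<xi> ** V)"

lemma glue_orthogonal:
  fixes Q :: "real^'r^'r"
  assumes "orthogonal_matrix Q" shows "glue (H ** Q) (V ** Q) = glue H V"
proof -
  have cancel: "A ** Q ** transpose Q = A" for A :: "real^'r^'x"
    using assms by (simp add: matrix_mul_assoc[symmetric] orthogonal_matrix_def)
  show ?thesis by (simp add: glue_def matrix_transpose_mul matrix_mul_assoc cancel)
qed

lemma glue_tangent_orthogonal:
  fixes Q :: "real^'r^'r"
  assumes "orthogonal_matrix Q"
  shows "glue_tangent (H ** Q) (V ** Q) (K ** Q) (W ** Q) = glue_tangent H V K W"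
proof -
  have cancel: "A ** Q ** transpose Q = A" for A :: "real^'r^'x"
    using assms by (simp add: matrix_mul_assoc[symmetric] orthogonal_matrix_def)
  show ?thesis by (simp add: glue_tangent_def matrix_transpose_mul matrix_mul_assoc cancel)
qed

lemma lift_orthogonal: "lift_H (V ** Q) \<xi> = lift_H V \<xi> ** Q" "lift_V (V ** Q) \<xi> = lift_V V \<xi> ** Q"
  by (simp_all add: lift_H_def lift_V_def matrix_mul_assoc matrix_mult_distribs)

lemma lift_linear:
  "lift_H V (a *\<^sub>R \<xi> + b *\<^sub>R \<xi>') = a *\<^sub>R lift_H V \<xi> + b *\<^sub>R lift_H V \<xi>'"
  "lift_V V (a *\<^sub>R \<xi> + b *\<^sub>R \<xi>') = a *\<^sub>R lift_V V \<xi> + b *\<^sub>R lift_V V \<xi>'"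
  by (simp_all add: lift_H_def lift_V_def matrix_mult_distribs)

lemma lift_scaleR: "lift_H V (a *\<^sub>R \<xi>) = a *\<^sub>R lift_H V \<xi>" "lift_V V (a *\<^sub>R \<xi>) = a *\<^sub>R lift_V V \<xi>"
  and lift_0: "lift_H V 0 = 0" "lift_V V 0 = 0"
  using lift_linear[of V a \<xi> 0 0] lift_linear[of V 0 0 0 0] by simp_all

lemma smooth_map_on_lift:
  fixes \<sigma> :: "'a::euclidean_space \<Rightarrow> real^'r^'n"
  assumes "smooth_map_on N \<sigma>" "smooth_map_on N \<xi>"
  shows "smooth_map_on N (\<lambda>z. lift_H (\<sigma> z) (\<xi> z))" "smooth_map_on N (\<lambda>z. lift_V (\<sigma> z) (\<xi> z))"
  unfolding lift_H_def lift_V_def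
  by (intro smooth_map_on_bilinear[OF bounded_bilinear_matrix_mult] assms
      smooth_map_on_linear[OF linear_fst] smooth_map_on_linear[OF linear_snd]
      smooth_map_on_linear[OF linear_uminus])+

lemma smooth_map_on_glue:
  assumes "smooth_map_on N f" "smooth_map_on N g"
  shows "smooth_map_on N (\<lambda>z. glue (f z) (g z))"
proof -
  have "smooth_on UNIV (\<lambda>x. mat 1 - x)"
    by (intro smooth_on_diff smooth_on_const smooth_on_id open_UNIV)
  then have aff: "smooth_map_on UNIV (\<lambda>x :: real^'n^'n. mat 1 - x)"
    by (rule smooth_on_imp_smooth_map_on[OF open_UNIV]) simp
  show ?thesis unfolding glue_def
    by (intro smooth_map_on_Pair smooth_map_on_bilinear[OF bounded_bilinear_matrix_mult] assms
        smooth_map_on_linear[OF linear_transpose] smooth_map_on_compose[OF _ aff]) auto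
qed

lemma smooth_map_on_glue_tangent:
  assumes "smooth_map_on N f" "smooth_map_on N g" "smooth_map_on N k" "smooth_map_on N w"
  shows "smooth_map_on N (\<lambda>z. glue_tangent (f z) (g z) (k z) (w z))"
proof -
  note T = smooth_map_on_linear[OF linear_transpose] and M = smooth_map_on_bilinear[OF bounded_bilinear_matrix_mult]
  have add: "smooth_map_on N (\<lambda>z. a z + b z)" if "smooth_map_on N a" "smooth_map_on N b"
    for a b :: "_ \<Rightarrow> 'x::euclidean_space"
  proof -
    have "linear (\<lambda>y :: 'x \<times> 'x. fst y + snd y)" by (simp add: linear_iff scaleR_add_right)
    from smooth_map_on_linear[OF this smooth_map_on_Pair[OF that]] show ?thesis by simp
  qed
  have neg: "smooth_map_on N (\<lambda>z. - a z)" if "smooth_map_on N a" for a :: "_ \<Rightarrow> 'x::euclidean_space"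
    by (rule smooth_map_on_linear[OF linear_uminus that])
  have "smooth_map_on N (\<lambda>z. (k z ** transpose (g z) + f z ** transpose (w z),
      - (w z ** transpose (g z)) + - (g z ** transpose (w z))))"
    by (intro smooth_map_on_Pair add neg M T assms)
  then show ?thesis by (simp add: glue_tangent_def)
qed

lemma orthogonally_homogeneousD:
  assumes "orthogonally_homogeneous M R" "orthogonal_matrix Q" "(X, \<xi>) \<in> tangent_bundle M"
  shows "R (X ** Q) (\<xi> ** Q) = R X \<xi> ** Q"
proof -
  have "\<forall>(X, \<xi>)\<in>tangent_bundle M. R X \<xi> ** Q = R (X ** Q) (\<xi> ** Q)"
    using assms(1,2) unfolding orthogonally_homogeneous_def by blast
  from bspec[OF this assms(3)] show ?thesis by simp
qed

lemma compatible_transportD: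
  assumes "compatible_transport M R T" "orthogonal_matrix Q" "(X, \<xi>', \<xi>) \<in> tangent_bundle_sum M"
  shows "T (X ** Q) (\<xi>' ** Q) (\<xi> ** Q) = T X \<xi>' \<xi> ** Q"
proof -
  have "\<forall>(X, \<xi>', \<xi>)\<in>tangent_bundle_sum M. T X \<xi>' \<xi> ** Q = T (X ** Q) (\<xi>' ** Q) (\<xi> ** Q)"
    using assms(1,2) unfolding compatible_transport_def by blast
  from bspec[OF this assms(3)] show ?thesis by simp
qed

locale compatible_transports = invariant_zero_set h \<iota>
  for h :: "real^'n^'m \<Rightarrow> real^'q" and \<iota> :: "'r::finite \<Rightarrow> 'n" +
  fixes RH :: "real^'r^'m \<Rightarrow> real^'r^'m \<Rightarrow> real^'r^'m"
    and TH :: "real^'r^'m \<Rightarrow> real^'r^'m \<Rightarrow> real^'r^'m \<Rightarrow> real^'r^'m"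
    and RSt :: "real^'r^'n \<Rightarrow> real^'r^'n \<Rightarrow> real^'r^'n"
    and TSt :: "real^'r^'n \<Rightarrow> real^'r^'n \<Rightarrow> real^'r^'n \<Rightarrow> real^'r^'n"
  assumes compH: "compatible_transport \<H> RH TH"
    and compSt: "compatible_transport Stiefel RSt TSt"
begin

definition lifted_retraction where
  "lifted_retraction H V \<xi> = glue (RH H (lift_H V \<xi>)) (RSt V (lift_V V \<xi>))"

definition lifted_transport where
  "lifted_transport H V \<xi>' \<xi> =
    (let H' = RH H (lift_H V \<xi>'); V' = RSt V (lift_V V \<xi>') in
     glue_tangent H' V' (TH H (lift_H V \<xi>') (lift_H V \<xi>))
       ((mat 1 - V' ** transpose V') ** TSt V (lift_V V \<xi>') (lift_V V \<xi>)))"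

lemma represents_glue: "represents h \<iota> (H, V) p \<longleftrightarrow> H \<in> \<H> \<and> V \<in> Stiefel \<and> p = glue H V"
  by (cases p) (auto simp: glue_def)

lemma represents_tangent_glue:
  "represents_tangent h \<iota> (H, V) (K, W) \<xi> \<longleftrightarrow>
    K \<in> tangent_space \<H> H \<and> transpose V ** W = 0 \<and> \<xi> = glue_tangent H V K W"
  by (cases \<xi>) (auto simp: glue_tangent_def)

lemma lift_tangent:
  assumes "represents h \<iota> (H, V) p" "\<xi> \<in> tangent_space (Mh CARD('r) h) p"
  shows "lift_H V \<xi> \<in> tangent_space \<H> H" "lift_V V \<xi> \<in> tangent_space Stiefel V"
    "transpose V ** lift_V V \<xi> = 0" "\<xi> = glue_tangent H V (lift_H V \<xi>) (lift_V V \<xi>)"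
    "(H, lift_H V \<xi>) \<in> tangent_bundle \<H>" "(V, lift_V V \<xi>) \<in> tangent_bundle Stiefel"
proof -
  have "represents_tangent h \<iota> (H, V) (lift_H V \<xi>, lift_V V \<xi>) \<xi>"
    unfolding lift_H_def lift_V_def by (rule tangent_imp_represents_tangent[OF assms])
  then show *: "lift_H V \<xi> \<in> tangent_space \<H> H" "transpose V ** lift_V V \<xi> = 0"
    "\<xi> = glue_tangent H V (lift_H V \<xi>) (lift_V V \<xi>)"
    by (auto simp: represents_tangent_glue)
  show **: "lift_V V \<xi> \<in> tangent_space Stiefel V"
    using assms(1) *(2) by (auto intro: Stiefel_tangentI simp: represents_glue)
  show "(H, lift_H V \<xi>) \<in> tangent_bundle \<H>" "(V, lift_V V \<xi>) \<in> tangent_bundle Stiefel"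
    using * ** assms(1) by (auto simp: tangent_bundle_def represents_glue)
qed

lemma retrH: "retraction_on \<H> RH" and transH: "vector_transport_on \<H> RH TH"
  and homH: "orthogonally_homogeneous \<H> RH"
  and retrSt: "retraction_on Stiefel RSt" and transSt: "vector_transport_on Stiefel RSt TSt"
  and homSt: "orthogonally_homogeneous Stiefel RSt"
  using compH compSt by (auto simp: compatible_transport_def vector_transport_on_def)

lemma represents_retraction:
  assumes "represents h \<iota> (H, V) p" "\<xi> \<in> tangent_space (Mh CARD('r) h) p"
  shows "represents h \<iota> (RH H (lift_H V \<xi>), RSt V (lift_V V \<xi>)) (lifted_retraction H V \<xi>)"
  using lift_tangent(5,6)[OF assms] retrH retrSt
  by (auto simp: represents_glue lifted_retraction_def retraction_on_def)

text \<open>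
  Passing to another representation multiplies \<open>H\<close>, \<open>V\<close> and the lifts by an orthogonal \<open>Q\<close> from the right.
  By homogeneity the retracted factors are multiplied by \<open>Q\<close> too, which cancels in \<open>glue\<close>.
\<close>

lemma lifted_retraction_unique:
  assumes 1: "represents h \<iota> (H, V) p" and 2: "represents h \<iota> (H2, V2) p"
    and \<xi>: "\<xi> \<in> tangent_space (Mh CARD('r) h) p"
  shows "lifted_retraction H2 V2 \<xi> = lifted_retraction H V \<xi>"
proof -
  obtain Q where Q: "orthogonal_matrix Q" "H2 = H ** Q" "V2 = V ** Q"
    using represents_unique[OF 1 2] .
  have "RH (H ** Q) (lift_H V \<xi> ** Q) = RH H (lift_H V \<xi>) ** Q"
    "RSt (V ** Q) (lift_V V \<xi> ** Q) = RSt V (lift_V V \<xi>) ** Q"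
    using orthogonally_homogeneousD[OF homH Q(1)] orthogonally_homogeneousD[OF homSt Q(1)] lift_tangent(5,6)[OF 1 \<xi>] by blast+
  then show ?thesis by (simp add: lifted_retraction_def Q(2,3) lift_orthogonal glue_orthogonal[OF Q(1)])
qed

text \<open>
  The argument for the retraction applies. In addition the projection \<open>I - V'V'\<^sup>T\<close> is the same for both
  representations, since \<open>V'\<close> only changes to \<open>V'Q\<close>.
\<close>

lemma lifted_transport_unique:
  assumes 1: "represents h \<iota> (H, V) p" and 2: "represents h \<iota> (H2, V2) p"
    and \<xi>': "\<xi>' \<in> tangent_space (Mh CARD('r) h) p" and \<xi>: "\<xi> \<in> tangent_space (Mh CARD('r) h) p"
  shows "lifted_transport H2 V2 \<xi>' \<xi> = lifted_transport H V \<xi>' \<xi>"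
proof -
  obtain Q where Q: "orthogonal_matrix Q" "H2 = H ** Q" "V2 = V ** Q"
    using represents_unique[OF 1 2] .
  have R: "RH (H ** Q) (lift_H V \<xi>' ** Q) = RH H (lift_H V \<xi>') ** Q"
    "RSt (V ** Q) (lift_V V \<xi>' ** Q) = RSt V (lift_V V \<xi>') ** Q"
    using orthogonally_homogeneousD[OF homH Q(1)] orthogonally_homogeneousD[OF homSt Q(1)] lift_tangent(5,6)[OF 1 \<xi>'] by blast+
  have "(H, lift_H V \<xi>', lift_H V \<xi>) \<in> tangent_bundle_sum \<H>"
    "(V, lift_V V \<xi>', lift_V V \<xi>) \<in> tangent_bundle_sum Stiefel"
    using lift_tangent[OF 1 \<xi>] lift_tangent[OF 1 \<xi>'] 1
    by (auto simp: tangent_bundle_sum_def represents_glue)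
  then have T: "TH (H ** Q) (lift_H V \<xi>' ** Q) (lift_H V \<xi> ** Q) = TH H (lift_H V \<xi>') (lift_H V \<xi>) ** Q"
    "TSt (V ** Q) (lift_V V \<xi>' ** Q) (lift_V V \<xi> ** Q) = TSt V (lift_V V \<xi>') (lift_V V \<xi>) ** Q"
    using compatible_transportD[OF compH Q(1)] compatible_transportD[OF compSt Q(1)] by blast+
  have cancel: "Q ** (transpose Q ** B) = B" for B :: "real^'x^'r"
    using Q(1) by (simp add: matrix_mul_assoc orthogonal_matrix_def)
  have "(mat 1 - (A ** Q) ** transpose (A ** Q)) ** (B ** Q) = (mat 1 - A ** transpose A) ** B ** Q"
    for A B :: "real^'r^'n"
    by (simp add: matrix_transpose_mul matrix_mul_assoc[symmetric] cancel)
  then show ?thesis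
    by (simp add: lifted_transport_def Let_def Q(2,3) lift_orthogonal R T glue_tangent_orthogonal[OF Q(1)])
qed

text \<open>
  The factor \<open>I - V'V'\<^sup>T\<close> is what makes the transported vector satisfy the normalization \<open>V'\<^sup>T W = 0\<close>; the
  transport on the Stiefel manifold by itself only yields a vector tangent there.
\<close>

lemma represents_transport:
  assumes 1: "represents h \<iota> (H, V) p"
    and \<xi>': "\<xi>' \<in> tangent_space (Mh CARD('r) h) p" and \<xi>: "\<xi> \<in> tangent_space (Mh CARD('r) h) p"
  shows "let H' = RH H (lift_H V \<xi>'); V' = RSt V (lift_V V \<xi>') in
           represents_tangent h \<iota> (H', V')
             (TH H (lift_H V \<xi>') (lift_H V \<xi>), (mat 1 - V' ** transpose V') ** TSt V (lift_V V \<xi>') (lift_V V \<xi>))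
             (lifted_transport H V \<xi>' \<xi>)"
proof -
  let ?H' = "RH H (lift_H V \<xi>')" and ?V' = "RSt V (lift_V V \<xi>')"
  have "?V' \<in> Stiefel"
    using represents_retraction[OF 1 \<xi>'] by (simp add: represents_glue)
  then have "transpose ?V' ** ((mat 1 - ?V' ** transpose ?V') ** A) = 0" for A :: "real^'r^'n"
    by (simp add: matrix_mult_distribs matrix_mul_assoc[symmetric] Stiefel_cancel(2))
  moreover have "(H, lift_H V \<xi>', lift_H V \<xi>) \<in> tangent_bundle_sum \<H>"
    using lift_tangent[OF 1 \<xi>] lift_tangent[OF 1 \<xi>'] 1
    by (auto simp: tangent_bundle_sum_def represents_glue)
  then have "TH H (lift_H V \<xi>') (lift_H V \<xi>) \<in> tangent_space \<H> ?H'"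
    using transH unfolding vector_transport_on_def by fastforce
  ultimately show ?thesis
    by (simp add: represents_tangent_glue lifted_transport_def Let_def)
qed

text \<open>
  Since tangent vectors have exactly one representative with respect to \<open>(H, V)\<close>, the quantification over
  representatives in the definition of an induced retraction can be eliminated.
\<close>

lemma induced_retraction_iff:
  "induced_retraction h \<iota> RH RSt R \<longleftrightarrow>
    (\<forall>p \<xi> H V. represents h \<iota> (H, V) p \<longrightarrow> \<xi> \<in> tangent_space (Mh CARD('r) h) p \<longrightarrow>
       R p \<xi> = lifted_retraction H V \<xi>)"
proof
  assume R: "induced_retraction h \<iota> RH RSt R"
  show "\<forall>p \<xi> H V. represents h \<iota> (H, V) p \<longrightarrow> \<xi> \<in> tangent_space (Mh CARD('r) h) p \<longrightarrow>
       R p \<xi> = lifted_retraction H V \<xi>"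
  proof (intro allI impI)
    fix p \<xi> H V
    assume p: "represents h \<iota> (H, V) p" and \<xi>: "\<xi> \<in> tangent_space (Mh CARD('r) h) p"
    have "(p, \<xi>) \<in> tangent_bundle (Mh CARD('r) h)"
      using represents_imp_Mh[OF p] \<xi> by (simp add: tangent_bundle_def)
    moreover have "represents_tangent h \<iota> (H, V) (lift_H V \<xi>, lift_V V \<xi>) \<xi>"
      unfolding lift_H_def lift_V_def by (rule tangent_imp_represents_tangent[OF p \<xi>])
    ultimately show "R p \<xi> = lifted_retraction H V \<xi>"
      using R p unfolding induced_retraction_def lifted_retraction_def glue_def by blast
  qed
next
  assume R: "\<forall>p \<xi> H V. represents h \<iota> (H, V) p \<longrightarrow> \<xi> \<in> tangent_space (Mh CARD('r) h) p \<longrightarrow>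
       R p \<xi> = lifted_retraction H V \<xi>"
  show "induced_retraction h \<iota> RH RSt R"
    unfolding induced_retraction_def
  proof clarify
    fix X G \<eta> \<zeta> H V K W
    assume *: "((X, G), (\<eta>, \<zeta>)) \<in> tangent_bundle (Mh CARD('r) h)"
      "represents h \<iota> (H, V) (X, G)" "represents_tangent h \<iota> (H, V) (K, W) (\<eta>, \<zeta>)"
    have "V \<in> Stiefel" using *(2) by (simp add: represents_glue)
    from represents_tangent_determined[OF this *(3)]
    have "K = lift_H V (\<eta>, \<zeta>)" "W = lift_V V (\<eta>, \<zeta>)" by (auto simp: lift_H_def lift_V_def)
    moreover have "R (X, G) (\<eta>, \<zeta>) = lifted_retraction H V (\<eta>, \<zeta>)"
      using R *(1,2) by (simp add: tangent_bundle_def)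
    ultimately show "R (X, G) (\<eta>, \<zeta>) = (RH H K ** transpose (RSt V W), mat 1 - RSt V W ** transpose (RSt V W))"
      by (simp add: lifted_retraction_def glue_def)
  qed
qed

definition chosen_rep where "chosen_rep p = (SOME (H, V). represents h \<iota> (H, V) p)"

lemma chosen_rep_represents:
  assumes "p \<in> Mh CARD('r) h" shows "represents h \<iota> (fst (chosen_rep p), snd (chosen_rep p)) p"
proof -
  have "\<exists>z. case z of (H, V) \<Rightarrow> represents h \<iota> (H, V) p" using represents_ex[OF assms] by (metis case_prod_conv)
  then show ?thesis unfolding chosen_rep_def by (metis (mono_tags, lifting) case_prod_beta' someI_ex)
qed

definition glued_transport where
  "glued_transport p \<xi>' \<xi> = lifted_transport (fst (chosen_rep p)) (snd (chosen_rep p)) \<xi>' \<xi>"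

lemma glued_transport_eq:
  assumes "represents h \<iota> (H, V) p"
    and "\<xi>' \<in> tangent_space (Mh CARD('r) h) p" "\<xi> \<in> tangent_space (Mh CARD('r) h) p"
  shows "glued_transport p \<xi>' \<xi> = lifted_transport H V \<xi>' \<xi>"
  unfolding glued_transport_def
  by (rule lifted_transport_unique[OF assms(1) chosen_rep_represents[OF represents_imp_Mh[OF assms(1)]] assms(2,3)])

lemma induced_retraction_ex: "\<exists>R. induced_retraction h \<iota> RH RSt R"
proof (intro exI)
  show "induced_retraction h \<iota> RH RSt (\<lambda>p \<xi>. lifted_retraction (fst (chosen_rep p)) (snd (chosen_rep p)) \<xi>)"
    unfolding induced_retraction_iff
    using lifted_retraction_unique chosen_rep_represents represents_imp_Mh by blast
qed

lemma induced_transport_glued_transport: "induced_transport h \<iota> RH TH RSt TSt glued_transport"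
  unfolding induced_transport_def
proof clarify
  fix X G \<eta>' \<zeta>' \<eta> \<zeta> H V K' W' K W
  assume *: "((X, G), (\<eta>', \<zeta>'), (\<eta>, \<zeta>)) \<in> tangent_bundle_sum (Mh CARD('r) h)"
    "represents h \<iota> (H, V) (X, G)" "represents_tangent h \<iota> (H, V) (K', W') (\<eta>', \<zeta>')"
    "represents_tangent h \<iota> (H, V) (K, W) (\<eta>, \<zeta>)"
  have V: "V \<in> Stiefel" using *(2) by (simp add: represents_glue)
  have eq: "K' = lift_H V (\<eta>', \<zeta>')" "W' = lift_V V (\<eta>', \<zeta>')" "K = lift_H V (\<eta>, \<zeta>)" "W = lift_V V (\<eta>, \<zeta>)"
    using represents_tangent_determined[OF V *(3)] represents_tangent_determined[OF V *(4)]
    by (auto simp: lift_H_def lift_V_def)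
  have tan: "(\<eta>', \<zeta>') \<in> tangent_space (Mh CARD('r) h) (X, G)" "(\<eta>, \<zeta>) \<in> tangent_space (Mh CARD('r) h) (X, G)"
    using *(1) by (auto simp: tangent_bundle_sum_def)
  show "let H' = RH H K'; V' = RSt V W' in
           represents_tangent h \<iota> (H', V')
             (TH H K' K, (mat 1 - V' ** transpose V') ** TSt V W' W)
             (glued_transport (X, G) (\<eta>', \<zeta>') (\<eta>, \<zeta>))"
    using represents_transport[OF *(2) tan] unfolding glued_transport_eq[OF *(2) tan] eq .
qed

text \<open>
  Near each point of \<open>Mh\<close> the representation can be chosen to depend smoothly on the point.
\<close>

lemma local_representation:
  assumes "p \<in> Mh CARD('r) h"
  obtains U s where "open U" "p \<in> U" "smooth_on U s"
    "\<And>q. q \<in> U \<Longrightarrow> q \<in> Mh CARD('r) h \<Longrightarrow> represents h \<iota> (fst q ** s q, s q) q"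
proof -
  obtain H V where "represents h \<iota> (H, V) p" using represents_ex[OF assms] .
  then have V: "V \<in> Stiefel" and G: "snd p = mat 1 - V ** transpose V" by (cases p; auto)+
  obtain U and s :: "real^'n^'n \<Rightarrow> real^'r^'n" where U: "open U" "snd p \<in> U" "smooth_on U s" "\<And>G. G \<in> U \<Longrightarrow> s G \<in> Stiefel"
    "\<And>G. G \<in> U \<Longrightarrow> G \<in> Grassmann (CARD('n) - CARD('r)) \<Longrightarrow> G = mat 1 - s G ** transpose (s G)"
    using Stiefel_section_ex[OF card_le V, folded G] by metis
  let ?U = "snd -` U :: ((real^'n^'m) \<times> (real^'n^'n)) set"
  have o: "open ?U" by (intro open_vimage U continuous_intros)
  show thesis
  proof (rule that[OF o, of "\<lambda>q. s (snd q)"])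
    show "smooth_on ?U (\<lambda>q. s (snd q))"
      by (rule smooth_on_compose[OF o linear_imp_smooth_on[OF linear_snd o] U(3)]) auto
    fix q assume q: "q \<in> ?U" "q \<in> Mh CARD('r) h"
    then have "snd q \<in> Grassmann (CARD('n) - CARD('r))" by (simp add: Mh_def split_beta)
    then show "represents h \<iota> (fst q ** s (snd q), s (snd q)) q"
      using represents_section[of "fst q" "snd q" "s (snd q)"] q U(4)[of "snd q"] U(5)[of "snd q"]
      unfolding prod.collapse by blast
  qed (use U in auto)
qed

lemma smooth_map_on_lifted_retraction:
  assumes rep: "\<And>z. z \<in> N \<Longrightarrow> represents h \<iota> (f z, g z) (p z)"
    and \<xi>: "\<And>z. z \<in> N \<Longrightarrow> \<xi> z \<in> tangent_space (Mh CARD('r) h) (p z)"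
    and smooth: "smooth_map_on N f" "smooth_map_on N g" "smooth_map_on N \<xi>"
  shows "smooth_map_on N (\<lambda>z. lifted_retraction (f z) (g z) (\<xi> z))"
  unfolding lifted_retraction_def
  by (intro smooth_map_on_glue smooth_map_on_retraction[OF retrH] smooth_map_on_retraction[OF retrSt] smooth_map_on_lift smooth
      lift_tangent[OF rep \<xi>])

lemma smooth_map_on_lifted_transport:
  assumes rep: "\<And>z. z \<in> N \<Longrightarrow> represents h \<iota> (f z, g z) (p z)"
    and \<xi>': "\<And>z. z \<in> N \<Longrightarrow> \<xi>' z \<in> tangent_space (Mh CARD('r) h) (p z)"
    and \<xi>: "\<And>z. z \<in> N \<Longrightarrow> \<xi> z \<in> tangent_space (Mh CARD('r) h) (p z)"
    and smooth: "smooth_map_on N f" "smooth_map_on N g" "smooth_map_on N \<xi>'" "smooth_map_on N \<xi>"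
  shows "smooth_map_on N (\<lambda>z. lifted_transport (f z) (g z) (\<xi>' z) (\<xi> z))"
proof -
  have RH: "smooth_map_on N (\<lambda>z. RH (f z) (lift_H (g z) (\<xi>' z)))"
    and RSt: "smooth_map_on N (\<lambda>z. RSt (g z) (lift_V (g z) (\<xi>' z)))"
    by (rule smooth_map_on_retraction[OF retrH smooth(1) smooth_map_on_lift(1)[OF smooth(2,3)] lift_tangent(5)[OF rep \<xi>']], assumption+)
       (rule smooth_map_on_retraction[OF retrSt smooth(2) smooth_map_on_lift(2)[OF smooth(2,3)] lift_tangent(6)[OF rep \<xi>']])
  have "(f z, lift_H (g z) (\<xi>' z), lift_H (g z) (\<xi> z)) \<in> tangent_bundle_sum \<H>"
    "(g z, lift_V (g z) (\<xi>' z), lift_V (g z) (\<xi> z)) \<in> tangent_bundle_sum Stiefel" if "z \<in> N" for z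
    using lift_tangent[OF rep \<xi>, OF that that] lift_tangent[OF rep \<xi>', OF that that] rep[OF that]
    by (auto simp: tangent_bundle_sum_def represents_glue)
  then have TH: "smooth_map_on N (\<lambda>z. TH (f z) (lift_H (g z) (\<xi>' z)) (lift_H (g z) (\<xi> z)))"
    and TSt: "smooth_map_on N (\<lambda>z. TSt (g z) (lift_V (g z) (\<xi>' z)) (lift_V (g z) (\<xi> z)))"
    by (intro smooth_map_on_transport[OF transH] smooth_map_on_transport[OF transSt] smooth_map_on_lift smooth; simp)+
  have "smooth_map_on N (\<lambda>z. snd (glue (RH (f z) (lift_H (g z) (\<xi>' z))) (RSt (g z) (lift_V (g z) (\<xi>' z)))))"
    by (intro smooth_map_on_linear[OF linear_snd] smooth_map_on_glue RH RSt)
  then show ?thesis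
    unfolding lifted_transport_def Let_def
    by (intro smooth_map_on_glue_tangent smooth_map_on_bilinear[OF bounded_bilinear_matrix_mult] RH RSt TH TSt)
      (simp add: glue_def)
qed

text \<open>
  To prove smoothness on a set \<open>N\<close> over \<open>Mh\<close>, such as a tangent bundle, it suffices to consider parts of
  \<open>N\<close> on which the base point has a representation \<open>(f z, g z)\<close> depending smoothly on \<open>z\<close>.
\<close>

lemma smooth_map_on_bundle:
  assumes N: "\<And>z. z \<in> N \<Longrightarrow> fst z \<in> Mh CARD('r) h"
    and F: "\<And>f g N'. N' \<subseteq> N \<Longrightarrow> smooth_map_on N' f \<Longrightarrow> smooth_map_on N' g \<Longrightarrow>
        (\<And>z. z \<in> N' \<Longrightarrow> represents h \<iota> (f z, g z) (fst z)) \<Longrightarrow> smooth_map_on N' F"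
  shows "smooth_map_on (N :: (((real^'n^'m) \<times> (real^'n^'n)) \<times> 'x::euclidean_space) set) F"
proof (rule smooth_map_on_local)
  fix z0 assume z0: "z0 \<in> N"
  obtain U s where U: "open U" "fst z0 \<in> U" "smooth_on U s"
    "\<And>q. q \<in> U \<Longrightarrow> q \<in> Mh CARD('r) h \<Longrightarrow> represents h \<iota> (fst q ** s q, s q) q"
    using local_representation[OF N[OF z0]] by metis
  let ?W = "fst -` U :: (((real^'n^'m) \<times> (real^'n^'n)) \<times> 'x) set"
  have o: "open ?W" by (intro open_vimage U continuous_intros)
  have s: "smooth_map_on (N \<inter> ?W) (\<lambda>z. s (fst z))"
    by (rule smooth_map_on_compose[OF smooth_map_on_linear[OF linear_fst smooth_map_on_id] smooth_on_imp_smooth_map_on[OF U(1,3) order_refl]]) auto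
  have "smooth_map_on (N \<inter> ?W) F"
  proof (rule F)
    show "smooth_map_on (N \<inter> ?W) (\<lambda>z. fst (fst z) ** s (fst z))"
      by (intro smooth_map_on_bilinear[OF bounded_bilinear_matrix_mult] s smooth_map_on_linear[OF linear_fst] smooth_map_on_id)
    show "smooth_map_on (N \<inter> ?W) (\<lambda>z. s (fst z))" by (rule s)
    show "represents h \<iota> (fst (fst z) ** s (fst z), s (fst z)) (fst z)" if "z \<in> N \<inter> ?W" for z
      using that U(4) N by auto
  qed auto
  then show "\<exists>W. open W \<and> z0 \<in> W \<and> smooth_map_on (N \<inter> W) F" using o U(2) by blast
qed

text \<open>
  Since lifts are linear, for fixed \<open>(H, V)\<close> the curve \<open>t \<mapsto> R p (t \<xi>)\<close> is glued from the corresponding curves of the two factor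
  retractions, whose velocities are the lifts of \<open>\<xi>\<close>; the product rule then returns \<open>\<xi>\<close>.
\<close>

lemma induced_retraction_on:
  assumes R: "induced_retraction h \<iota> RH RSt R"
  shows "retraction_on (Mh CARD('r) h) R"
proof -
  have R: "R p \<xi> = lifted_retraction H V \<xi>"
    if "represents h \<iota> (H, V) p" "\<xi> \<in> tangent_space (Mh CARD('r) h) p" for p \<xi> H V
    using R that unfolding induced_retraction_iff by blast
  have "R p \<xi> \<in> Mh CARD('r) h \<and> R p 0 = p \<and> ((\<lambda>t. R p (t *\<^sub>R \<xi>)) has_vector_derivative \<xi>) (at 0)"
    if p\<xi>: "(p, \<xi>) \<in> tangent_bundle (Mh CARD('r) h)" for p \<xi>
  proof -
    have p: "p \<in> Mh CARD('r) h" and \<xi>: "\<xi> \<in> tangent_space (Mh CARD('r) h) p"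
      using p\<xi> by (auto simp: tangent_bundle_def)
    obtain H V where HV: "represents h \<iota> (H, V) p" using represents_ex[OF p] .
    note L = lift_tangent[OF HV \<xi>]
    have 0: "RH H 0 = H" "RSt V 0 = V"
      and dH: "((\<lambda>t. RH H (t *\<^sub>R lift_H V \<xi>)) has_vector_derivative lift_H V \<xi>) (at 0)"
      and dV: "((\<lambda>t. RSt V (t *\<^sub>R lift_V V \<xi>)) has_vector_derivative lift_V V \<xi>) (at 0)"
      using retrH retrSt L(5,6) unfolding retraction_on_def by fastforce+
    note dVT = has_vector_derivative_transpose[OF dV]
    have eq: "R p (t *\<^sub>R \<xi>) = glue (RH H (t *\<^sub>R lift_H V \<xi>)) (RSt V (t *\<^sub>R lift_V V \<xi>))" for t
      using R[OF HV tangent_space_scaleR[OF \<xi>]] by (simp add: lifted_retraction_def lift_scaleR)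
    have "((\<lambda>t. R p (t *\<^sub>R \<xi>)) has_vector_derivative
        (RH H (0 *\<^sub>R lift_H V \<xi>) ** transpose (lift_V V \<xi>) + lift_H V \<xi> ** transpose (RSt V (0 *\<^sub>R lift_V V \<xi>)),
         0 - (RSt V (0 *\<^sub>R lift_V V \<xi>) ** transpose (lift_V V \<xi>) + lift_V V \<xi> ** transpose (RSt V (0 *\<^sub>R lift_V V \<xi>))))) (at 0)"
      unfolding eq glue_def
      by (intro has_vector_derivative_Pair has_vector_derivative_diff has_vector_derivative_const
          has_vector_derivative_matrix_mult dH dV dVT)
    moreover have "(RH H (0 *\<^sub>R lift_H V \<xi>) ** transpose (lift_V V \<xi>) + lift_H V \<xi> ** transpose (RSt V (0 *\<^sub>R lift_V V \<xi>)),
         0 - (RSt V (0 *\<^sub>R lift_V V \<xi>) ** transpose (lift_V V \<xi>) + lift_V V \<xi> ** transpose (RSt V (0 *\<^sub>R lift_V V \<xi>)))) =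
       glue_tangent H V (lift_H V \<xi>) (lift_V V \<xi>)"
      by (simp add: 0 glue_tangent_def)
    ultimately have "((\<lambda>t. R p (t *\<^sub>R \<xi>)) has_vector_derivative \<xi>) (at 0)" using L(4) by simp
    moreover have "R p 0 = p"
      using eq[of 0] HV by (simp add: 0 represents_glue)
    moreover have "R p \<xi> \<in> Mh CARD('r) h"
      using represents_imp_Mh[OF represents_retraction[OF HV \<xi>]] R[OF HV \<xi>] by simp
    ultimately show ?thesis by blast
  qed
  moreover have "smooth_map_on (tangent_bundle (Mh CARD('r) h)) (\<lambda>(p, \<xi>). R p \<xi>)"
  proof (rule smooth_map_on_bundle)
    fix f g N
    assume N: "N \<subseteq> tangent_bundle (Mh CARD('r) h)" and s: "smooth_map_on N f" "smooth_map_on N g"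
      and rep: "\<And>z. z \<in> N \<Longrightarrow> represents h \<iota> (f z, g z) (fst z)"
    have t: "snd z \<in> tangent_space (Mh CARD('r) h) (fst z)" if "z \<in> N" for z
      using N that by (auto simp: tangent_bundle_def)
    have "smooth_map_on N (\<lambda>z. lifted_retraction (f z) (g z) (snd z))"
      by (rule smooth_map_on_lifted_retraction[OF rep t s smooth_map_on_linear[OF linear_snd smooth_map_on_id]])
    then show "smooth_map_on N (\<lambda>(p, \<xi>). R p \<xi>)"
      by (rule smooth_map_on_cong[rotated]) (use R[OF rep t] in \<open>simp add: split_beta\<close>)
  qed (auto simp: tangent_bundle_def)
  ultimately show ?thesis unfolding retraction_on_def by fast
qed

text \<open>
  Tangency is \<open>represents_transport\<close>. For \<open>\<xi>' = 0\<close> the factor transports are the identity and the projection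
  \<open>I - VV\<^sup>T\<close> fixes the lift of \<open>\<xi>\<close>. Linearity holds because, once \<open>p\<close> and \<open>\<xi>'\<close> are fixed, lifting, the factor transports, the
  projection and \<open>glue_tangent\<close> are linear. Smoothness is checked with smooth local representations.
\<close>

lemma glued_transport_vector_transport_on:
  assumes R: "induced_retraction h \<iota> RH RSt R"
  shows "vector_transport_on (Mh CARD('r) h) R glued_transport"
proof -
  have R': "R p \<xi> = lifted_retraction H V \<xi>"
    if "represents h \<iota> (H, V) p" "\<xi> \<in> tangent_space (Mh CARD('r) h) p" for p \<xi> H V
    using R that unfolding induced_retraction_iff by blast
  have tan: "glued_transport p \<xi>' \<xi> \<in> tangent_space (Mh CARD('r) h) (R p \<xi>')"
    if p: "p \<in> Mh CARD('r) h" and \<xi>': "\<xi>' \<in> tangent_space (Mh CARD('r) h) p"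
      and \<xi>: "\<xi> \<in> tangent_space (Mh CARD('r) h) p" for p \<xi>' \<xi>
  proof -
    obtain H V where HV: "represents h \<iota> (H, V) p" using represents_ex[OF p] .
    show ?thesis
      using represents_tangent_imp_tangent[OF represents_retraction[OF HV \<xi>'] represents_transport[OF HV \<xi>' \<xi>, unfolded Let_def]]
        R'[OF HV \<xi>'] glued_transport_eq[OF HV \<xi>' \<xi>] by simp
  qed
  have zero: "glued_transport p 0 \<xi> = \<xi>"
    if p: "p \<in> Mh CARD('r) h" and \<xi>: "\<xi> \<in> tangent_space (Mh CARD('r) h) p" for p \<xi>
  proof -
    obtain H V where HV: "represents h \<iota> (H, V) p" using represents_ex[OF p] .
    note L = lift_tangent[OF HV \<xi>]
    have "RH H 0 = H" "RSt V 0 = V"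
      using retrH retrSt L(5,6) unfolding retraction_on_def by fastforce+
    moreover have "TH H 0 (lift_H V \<xi>) = lift_H V \<xi>" "TSt V 0 (lift_V V \<xi>) = lift_V V \<xi>"
      using transH transSt L(5,6) unfolding vector_transport_on_def by fastforce+
    moreover have "(mat 1 - V ** transpose V) ** lift_V V \<xi> = lift_V V \<xi>"
      by (simp add: matrix_mult_distribs matrix_mul_assoc[symmetric] L(3))
    ultimately have "lifted_transport H V 0 \<xi> = \<xi>"
      using L(4) by (simp add: lifted_transport_def Let_def lift_0)
    then show ?thesis using glued_transport_eq[OF HV tangent_space_zero[OF p] \<xi>] by simp
  qed
  have lin: "glued_transport p u (a *\<^sub>R v + b *\<^sub>R w) = a *\<^sub>R glued_transport p u v + b *\<^sub>R glued_transport p u w"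
    if p: "p \<in> Mh CARD('r) h" and u: "u \<in> tangent_space (Mh CARD('r) h) p"
      and v: "v \<in> tangent_space (Mh CARD('r) h) p" and w: "w \<in> tangent_space (Mh CARD('r) h) p"
    for p u v w and a b :: real
  proof -
    let ?H = "fst (chosen_rep p)" and ?V = "snd (chosen_rep p)"
    note HV = chosen_rep_represents[OF p]
    have H: "?H \<in> \<H>" "?V \<in> Stiefel" using iffD1[OF represents_glue HV] by blast+
    have "TH ?H (lift_H ?V u) (a *\<^sub>R lift_H ?V v + b *\<^sub>R lift_H ?V w) =
        a *\<^sub>R TH ?H (lift_H ?V u) (lift_H ?V v) + b *\<^sub>R TH ?H (lift_H ?V u) (lift_H ?V w)"
      using transH H lift_tangent(1)[OF HV u] lift_tangent(1)[OF HV v] lift_tangent(1)[OF HV w]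
      unfolding vector_transport_on_def by blast
    moreover have "TSt ?V (lift_V ?V u) (a *\<^sub>R lift_V ?V v + b *\<^sub>R lift_V ?V w) =
        a *\<^sub>R TSt ?V (lift_V ?V u) (lift_V ?V v) + b *\<^sub>R TSt ?V (lift_V ?V u) (lift_V ?V w)"
      using transSt H lift_tangent(2)[OF HV u] lift_tangent(2)[OF HV v] lift_tangent(2)[OF HV w]
      unfolding vector_transport_on_def by blast
    ultimately show ?thesis
      by (simp add: glued_transport_def lifted_transport_def Let_def lift_linear glue_tangent_def
          matrix_mult_distribs transpose_simps algebra_simps)
  qed
  have smooth: "smooth_map_on (tangent_bundle_sum (Mh CARD('r) h)) (\<lambda>(p, u, v). (R p u, glued_transport p u v))"
  proof (rule smooth_map_on_bundle)
    fix f g N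
    assume N: "N \<subseteq> tangent_bundle_sum (Mh CARD('r) h)" and s: "smooth_map_on N f" "smooth_map_on N g"
      and rep: "\<And>z. z \<in> N \<Longrightarrow> represents h \<iota> (f z, g z) (fst z)"
    have t: "fst (snd z) \<in> tangent_space (Mh CARD('r) h) (fst z)"
      "snd (snd z) \<in> tangent_space (Mh CARD('r) h) (fst z)" if "z \<in> N" for z
      using N that by (auto simp: tangent_bundle_sum_def)
    note st = smooth_map_on_linear[OF linear_snd smooth_map_on_id]
    have "smooth_map_on N (\<lambda>z. (lifted_retraction (f z) (g z) (fst (snd z)),
        lifted_transport (f z) (g z) (fst (snd z)) (snd (snd z))))"
      by (intro smooth_map_on_Pair
          smooth_map_on_lifted_retraction[OF rep t(1) s smooth_map_on_linear[OF linear_fst st]]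
          smooth_map_on_lifted_transport[OF rep t s smooth_map_on_linear[OF linear_fst st] smooth_map_on_linear[OF linear_snd st]])
    then show "smooth_map_on N (\<lambda>(p, u, v). (R p u, glued_transport p u v))"
      by (rule smooth_map_on_cong[rotated])
         (use R'[OF rep t(1)] glued_transport_eq[OF rep t] in \<open>simp add: split_beta\<close>)
  qed (auto simp: tangent_bundle_sum_def)
  show ?thesis
    unfolding vector_transport_on_def
    using induced_retraction_on[OF R] tan zero lin smooth
    by (auto simp: tangent_bundle_sum_def tangent_bundle_def)
qed

end

theorem proposition13:
  fixes h :: "real^'n^'m \<Rightarrow> real^'q"
    and \<iota> :: "'r::finite \<Rightarrow> 'n"
    and RH :: "real^'r^'m \<Rightarrow> real^'r^'m \<Rightarrow> real^'r^'m"
    and TH :: "real^'r^'m \<Rightarrow> real^'r^'m \<Rightarrow> real^'r^'m \<Rightarrow> real^'r^'m"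
    and RSt :: "real^'r^'n \<Rightarrow> real^'r^'n \<Rightarrow> real^'r^'n"
    and TSt :: "real^'r^'n \<Rightarrow> real^'r^'n \<Rightarrow> real^'r^'n \<Rightarrow> real^'r^'n"
  assumes "inj \<iota>" and "CARD('r) \<le> CARD('m)"
    and "smooth_on UNIV h"
    and "orthogonally_invariant h"
    and "\<And>X. h X = 0 \<Longrightarrow> dim (range (frechet_derivative h (at X))) = CARD('q)"
    and "compatible_transport (Hr h \<iota>) RH TH"
    and "compatible_transport Stiefel RSt TSt"
  shows "(\<exists>R. induced_retraction h \<iota> RH RSt R) \<and>
    (\<forall>R. induced_retraction h \<iota> RH RSt R \<longrightarrow>
      (\<exists>T. induced_transport h \<iota> RH TH RSt TSt T \<and>
           vector_transport_on (Mh CARD('r) h) R T))"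
proof -
  interpret compatible_transports h \<iota> RH TH RSt TSt
    using assms(1,4,6,7) by unfold_locales
  show ?thesis
    using induced_retraction_ex induced_transport_glued_transport glued_transport_vector_transport_on by blast
qed

end
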